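(* Let $c>0$, $0<\beta<\frac2c$, $\gamma\equiv c$, and let $f\in C^2(\mathbb{R}^d)$ with $\inf f>-\infty$ be a Morse function. Consider $\ddot x(t)+c\dot x(t)+\nabla f(x(t)+\beta\dot x(t))=0$, $x(0)=x_0$, $\dot x(0)=v_0$. If the solution $x$ is bounded on $\mathbb{R}_+$, then $\nabla f\circ x\in L^2$, $\|\nabla f(x(t))\|\to0$, $\|\dot x(t)\|\to0$, $\dot x\in L^1(\mathbb{R}_+;\mathbb{R}^d)$ and $x(t)$ converges to a critical point of $f$. If moreover $\beta\neq\frac1c$ and the solution is bounded for every initial condition, then for Lebesgue almost all $(x_0,v_0)\in\mathbb{R}^d\times\mathbb{R}^d$, $x(t)$ converges as $t\to+\infty$ to a local minimum of $f$.
   Context: A function $f\in C^2(\mathbb{R}^d)$ is Morse if (i) for each critical point $\hat x$ (i.e. $\nabla f(\hat x)=0$), $\nabla^2 f(\hat x)$ is nonsingular, and (ii) the set of critical points is of the form $\bigcup_{k\in I}\{\hat x_k\}$ for a nonempty $I\subseteq\mathbb{N}$. A local minimum of $f$ is a critical point $\hat x$ at which $\nabla^2 f(\hat x)$ is positive definite. *)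

theory Defs
  imports "HOL-Analysis.Analysis"
begin

definition C2_grad_hess ::
  "(real^'n \<Rightarrow> real) \<Rightarrow> (real^'n \<Rightarrow> real^'n) \<Rightarrow> (real^'n \<Rightarrow> real^'n^'n) \<Rightarrow> bool" where
  "C2_grad_hess f g H \<longleftrightarrow>
     (\<forall>x. (f has_derivative (\<lambda>h. g x \<bullet> h)) (at x)) \<and>
     (\<forall>x. (g has_derivative (\<lambda>h. H x *v h)) (at x)) \<and>
     continuous_on UNIV H"

definition critical_point :: "(real^'n \<Rightarrow> real^'n) \<Rightarrow> real^'n \<Rightarrow> bool" where
  "critical_point g x \<longleftrightarrow> g x = 0"

definition morse ::
  "(real^'n \<Rightarrow> real^'n) \<Rightarrow> (real^'n \<Rightarrow> real^'n^'n) \<Rightarrow> bool" where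
  "morse g H \<longleftrightarrow>
     (\<forall>x. critical_point g x \<longrightarrow> invertible (H x)) \<and>
     (\<exists>(I::nat set) xk. I \<noteq> {} \<and> {x. critical_point g x} = (\<Union>k\<in>I. {xk k}))"

definition local_min_pt ::
  "(real^'n \<Rightarrow> real^'n) \<Rightarrow> (real^'n \<Rightarrow> real^'n^'n) \<Rightarrow> real^'n \<Rightarrow> bool" where
  "local_min_pt g H x \<longleftrightarrow> critical_point g x \<and> (\<forall>v. v \<noteq> 0 \<longrightarrow> v \<bullet> (H x *v v) > 0)"

definition is_solution ::
  "(real^'n \<Rightarrow> real^'n) \<Rightarrow> real \<Rightarrow> real \<Rightarrow> real^'n \<Rightarrow> real^'n
   \<Rightarrow> (real \<Rightarrow> real^'n) \<Rightarrow> (real \<Rightarrow> real^'n) \<Rightarrow> bool" where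
  "is_solution g c \<beta> x0 v0 x x' \<longleftrightarrow>
     x 0 = x0 \<and> x' 0 = v0 \<and>
     (\<forall>t\<ge>0. (x has_vector_derivative x' t) (at t within {0..})) \<and>
     (\<forall>t\<ge>0. \<exists>a. (x' has_vector_derivative a) (at t within {0..}) \<and>
                 a + c *\<^sub>R x' t + g (x t + \<beta> *\<^sub>R x' t) = 0)"

end

theory Submission
  imports Defs
begin

text \<open>
  Put \<open>y = x + \<beta> x'\<close>. The energy \<open>f y + \<bar>x'\<bar>\<^sup>2 / 2\<close> decreases at a rate of at least
  \<open>(\<beta> \<bar>\<nabla>f y\<bar>\<^sup>2 + c \<bar>x'\<bar>\<^sup>2) / 4\<close>, which makes both terms square integrable and, being Lipschitz,
  vanishing at infinity. Critical points are isolated, so a bounded trajectory converges to one.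

  Null sets are obtained without a stable manifold theorem. Let \<open>w\<close> and \<open>\<eta>\<close> be the differences of
  the \<open>y\<close>-components and of the velocities of two solutions that stay near a saddle \<open>p\<close>, with
  Hessian \<open>A\<close>. If \<open>w \<bullet> A w + \<bar>\<eta>\<bar>\<^sup>2\<close> were ever negative, it would tend to minus infinity exponentially
  fast; hence it is nonnegative. This confines the states of trapped solutions at any fixed time to a Lipschitz
  graph over a hyperplane transversal to a direction \<open>a\<close> with \<open>a \<bullet> A a < 0\<close>. The map back
  to the initial condition is Lipschitz by Gronwall's inequality, so the initial conditions form a
  null set; countably many such sets cover the exceptional set.
\<close>

section \<open>Norm bounds, calculus and null sets\<close>

lemma norm_matrix_vector_mult_le:
  fixes A :: "real^'n^'m" and x :: "real^'n"
  shows "norm (A *v x) \<le> norm A * norm x"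
proof -
  \<comment> \<open>\<open>norm A\<close> is the Frobenius norm, that is, the L2 norm of the row
    norms, so Cauchy-Schwarz is applied row by row.\<close>
  have "norm (A *v x) \<le> L2_set (\<lambda>i. norm (A $ i) * norm x) UNIV"
    unfolding norm_vec_def[of "A *v x"]
    by (rule L2_set_mono) (auto simp: matrix_vector_mul_component Cauchy_Schwarz_ineq2)
  also have "\<dots> = norm A * norm x"
    by (simp add: norm_vec_def[of A] L2_set_left_distrib)
  finally show ?thesis .
qed

text \<open>Gives the decay of the energy and, applied to functions with an exponential weight, does
  the work of Gronwall's inequality.\<close>

lemma has_real_derivative_nonneg_mono_atLeast:
  fixes F F' :: "real \<Rightarrow> real"
  assumes "\<And>t. t \<ge> a \<Longrightarrow> (F has_real_derivative F' t) (at t within {a..})"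
    and "\<And>t. t \<ge> a \<Longrightarrow> F' t \<ge> 0" and "a \<le> s" "s \<le> t"
  shows "F s \<le> F t"
proof -
  have "\<exists>u\<in>{s..t}. F t - F s = (\<lambda>h. F' u * h) (t - s)"
  proof (rule mvt_very_simple[OF \<open>s \<le> t\<close>])
    fix u assume "s \<le> u" "u \<le> t"
    then show "(F has_derivative (*) (F' u)) (at u within {s..t})"
      using assms(1)[of u] \<open>a \<le> s\<close>
      by (auto simp: has_field_derivative_def intro: has_derivative_subset)
  qed
  then obtain u where "u \<in> {s..t}" "F t - F s = F' u * (t - s)" by auto
  moreover have "F' u * (t - s) \<ge> 0"
    using assms(2)[of u] assms(3,4) \<open>u \<in> {s..t}\<close> by auto
  ultimately show ?thesis by linarith
qed

lemma has_vector_derivative_norm_bound_atLeast: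
  fixes F F' :: "real \<Rightarrow> 'a::euclidean_space"
  assumes "\<And>t. t \<ge> a \<Longrightarrow> (F has_vector_derivative F' t) (at t within {a..})"
    and "\<And>t. t \<ge> a \<Longrightarrow> norm (F' t) \<le> K" and "a \<le> s" "a \<le> t"
  shows "norm (F t - F s) \<le> K * \<bar>t - s\<bar>"
proof -
  have "norm (F t - F s) \<le> K * norm (t - s)"
  proof (rule differentiable_bound[of "{a..}" F "\<lambda>t h. h *\<^sub>R F' t"])
    show "onorm (\<lambda>h. h *\<^sub>R F' u) \<le> K" if "u \<in> {a..}" for u
      using assms(2)[of u] that by (simp add: onorm_scaleR_left onorm_id)
  qed (use assms in \<open>auto simp: has_vector_derivative_def\<close>)
  then show ?thesis by simp
qed

text \<open>The fundamental theorem of calculus bounds the integral of \<open>norm (h t)\<close>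
  over each \<open>{a..a + real n}\<close> by \<open>B - F a\<close>, and monotone convergence
  carries this bound over to the half-line.\<close>

lemma set_integrable_atLeast_dominated_by_derivative:
  fixes h :: "real \<Rightarrow> 'a::euclidean_space" and F F' :: "real \<Rightarrow> real"
  assumes cont: "continuous_on {a..} h"
    and der: "\<And>t. t \<ge> a \<Longrightarrow> (F has_real_derivative F' t) (at t within {a..})"
    and le: "\<And>t. t \<ge> a \<Longrightarrow> norm (h t) \<le> F' t"
    and bd: "\<And>t. t \<ge> a \<Longrightarrow> F t \<le> B"
  shows "set_integrable lborel {a..} h"
proof -
  have meas: "(\<lambda>t. indicator {a..} t *\<^sub>R h t) \<in> borel_measurable borel"
    using borel_measurable_continuous_on_indicator[OF _ cont] by simp
  define f where "f n t = ennreal (norm (indicator {a..a + real n} t *\<^sub>R h t))" for n t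
  have int: "integral\<^sup>N lborel (f n) \<le> ennreal (B - F a)" for n
  proof -
    let ?I = "{a..a + real n}"
    have cn: "continuous_on ?I (\<lambda>t. norm (h t))"
      using cont by (intro continuous_intros) (auto intro: continuous_on_subset)
    have si: "set_integrable lborel ?I (\<lambda>t. norm (h t))"
      by (rule borel_integrable_atLeastAtMost') (rule cn)
    \<comment> \<open>The gauge integral copes with an arbitrary derivative \<open>F'\<close>;
      continuity is known for \<open>h\<close> alone.\<close>
    have "(F' has_integral (F (a + real n) - F a)) ?I"
    proof (rule fundamental_theorem_of_calculus)
      fix t assume "t \<in> ?I"
      then show "(F has_vector_derivative F' t) (at t within ?I)"
        using der[of t] by (auto simp flip: has_real_derivative_iff_has_vector_derivative
            intro: has_field_derivative_subset)
    qed simp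
    then have "integral ?I (\<lambda>t. norm (h t)) \<le> F (a + real n) - F a"
      using integral_le[OF integrable_continuous_interval[OF cn], of F'] le
      by (auto simp: integral_unique has_integral_integrable)
    also have "\<dots> \<le> B - F a" using bd[of "a + real n"] by simp
    finally have "(LBINT t:?I. norm (h t)) \<le> B - F a"
      using set_borel_integral_eq_integral(2)[OF si] by simp
    moreover have "integral\<^sup>N lborel (f n) = ennreal (LBINT t:?I. norm (h t))"
      unfolding f_def set_lebesgue_integral_def
      using si unfolding set_integrable_def
      by (subst nn_integral_eq_integral[symmetric]) auto
    ultimately show ?thesis by (simp add: ennreal_leI)
  qed
  have sup: "(SUP n. f n t) = ennreal (norm (indicator {a..} t *\<^sub>R h t))" for t
  proof (rule antisym)
    show "(SUP n. f n t) \<le> ennreal (norm (indicator {a..} t *\<^sub>R h t))"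
      by (rule SUP_least) (auto simp: f_def indicator_def)
    obtain n where "t - a \<le> real n" using real_arch_simple by blast
    then have "ennreal (norm (indicator {a..} t *\<^sub>R h t)) = f n t"
      by (auto simp: f_def indicator_def)
    also have "\<dots> \<le> (SUP n. f n t)" by (rule SUP_upper) simp
    finally show "ennreal (norm (indicator {a..} t *\<^sub>R h t)) \<le> (SUP n. f n t)" .
  qed
  have "(\<integral>\<^sup>+t. ennreal (norm (indicator {a..} t *\<^sub>R h t)) \<partial>lborel) = (SUP n. integral\<^sup>N lborel (f n))"
    unfolding sup[symmetric]
  proof (rule nn_integral_monotone_convergence_SUP)
    show "incseq f"
      by (auto simp: incseq_def le_fun_def f_def indicator_def)
    show "f n \<in> borel_measurable lborel" for n
    proof -
      \<comment> \<open>Splitting the indicator of the interval into two factors reduces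
        measurability to \<open>meas\<close>.\<close>
      have eq: "f n = (\<lambda>t. ennreal (norm (indicator {..a + real n} t *\<^sub>R (indicator {a..} t *\<^sub>R h t))))"
        by (auto simp: f_def indicator_def)
      have m: "(\<lambda>t. indicator {..a + real n} t *\<^sub>R (indicator {a..} t *\<^sub>R h t)) \<in> borel_measurable lborel"
        unfolding measurable_lborel2 by (rule borel_measurable_scaleR[OF _ meas]) simp
      show ?thesis
        unfolding eq by (rule measurable_compose[OF measurable_compose[OF m borel_measurable_norm] measurable_ennreal])
    qed
  qed
  also have "\<dots> \<le> ennreal (B - F a)" by (rule SUP_least) (rule int)
  also have "\<dots> < \<infinity>" by simp
  finally show ?thesis
    unfolding set_integrable_def by (intro integrableI_bounded) (use meas in auto)
qed

text \<open>Barbalat's argument: a Lipschitz function that is not small at some time is not small on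
  an interval of fixed length, which costs a fixed amount of the bounded monotone function.\<close>

lemma tendsto_zero_of_square_le_derivative:
  fixes q :: "real \<Rightarrow> 'a::real_normed_vector" and F F' :: "real \<Rightarrow> real"
  assumes der: "\<And>t. t \<ge> a \<Longrightarrow> (F has_real_derivative F' t) (at t within {a..})"
    and le: "\<And>t. t \<ge> a \<Longrightarrow> \<kappa> * (norm (q t))\<^sup>2 \<le> F' t" and "\<kappa> > 0"
    and bd: "\<And>t. t \<ge> a \<Longrightarrow> F t \<le> B"
    and lip: "\<And>s t. a \<le> s \<Longrightarrow> a \<le> t \<Longrightarrow> norm (q t - q s) \<le> K * \<bar>t - s\<bar>"
  shows "(q \<longlongrightarrow> 0) at_top"
proof (rule tendstoI)
  fix e :: real assume "e > 0"
  have "0 \<le> norm (q (a + 1) - q a)" by simp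
  also have "\<dots> \<le> K" using lip[of a "a + 1"] by simp
  finally have K0: "K \<ge> 0" .
  \<comment> \<open>Within a time \<open>\<tau>\<close> the norm of \<open>q\<close> changes by at
    most \<open>e / 2\<close>. The summand 1 in the denominator covers \<open>K = 0\<close>.\<close>
  define \<tau> where "\<tau> = e / (2 * (K + 1))"
  have tau: "\<tau> > 0" "K * \<tau> \<le> e / 2"
    using \<open>e > 0\<close> K0 by (auto simp: \<tau>_def field_simps)
  \<comment> \<open>A lower bound for \<open>F'\<close> wherever
    \<open>norm (q t) \<ge> e / 2\<close>.\<close>
  define \<mu> where "\<mu> = \<kappa> * (e / 2)\<^sup>2"
  have mu: "\<mu> > 0" using \<open>\<kappa> > 0\<close> \<open>e > 0\<close> by (simp add: \<mu>_def)
  have F0: "F' t \<ge> 0" if "t \<ge> a" for t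
    using le[OF that] \<open>\<kappa> > 0\<close> by (meson mult_nonneg_nonneg less_imp_le order_trans zero_le_power2)
  have mono: "F s \<le> F t" if "a \<le> s" "s \<le> t" for s t
    using has_real_derivative_nonneg_mono_atLeast[OF der F0 that] by simp
  define S where "S = Sup (F ` {a..})"
  have bdd: "bdd_above (F ` {a..})" using bd by (auto intro!: bdd_aboveI[where M=B])
  have up: "F t \<le> S" if "t \<ge> a" for t
    unfolding S_def using that bdd by (intro cSup_upper) auto
  \<comment> \<open>After \<open>T\<close> the function \<open>F\<close> can rise by less than
    \<open>\<mu> * \<tau>\<close>, too little to pay for one interval of length
    \<open>\<tau>\<close> on which \<open>q\<close> stays large.\<close>
  have "S - \<mu> * \<tau> < S" using mu tau by simp
  then obtain T where T: "T \<ge> a" "F T > S - \<mu> * \<tau>"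
    unfolding S_def using less_cSup_iff[OF _ bdd] by auto
  have "norm (q t) < e" if "t \<ge> T" for t
  proof (rule ccontr)
    assume "\<not> norm (q t) < e"
    have ta: "t \<ge> a" using that T by simp
    have big: "F' u \<ge> \<mu>" if "t \<le> u" "u \<le> t + \<tau>" for u
    proof -
      have "norm (q u - q t) \<le> K * \<bar>u - t\<bar>" by (rule lip) (use that ta in auto)
      also have "\<dots> \<le> K * \<tau>" using that K0 by (intro mult_left_mono) auto
      finally have "norm (q u - q t) \<le> e / 2" using tau by simp
      then have "norm (q u) \<ge> e / 2"
        using \<open>\<not> norm (q t) < e\<close> norm_triangle_ineq2[of "q t" "q u"] by (simp add: norm_minus_commute)
      then have "(e / 2)\<^sup>2 \<le> (norm (q u))\<^sup>2" using \<open>e > 0\<close> by (intro power_mono) auto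
      then show ?thesis
        using le[of u] that ta \<open>\<kappa> > 0\<close> unfolding \<mu>_def by (smt (verit) mult_left_mono)
    qed
    have "\<exists>u\<in>{t..t + \<tau>}. F (t + \<tau>) - F t = (\<lambda>h. F' u * h) (t + \<tau> - t)"
    proof (rule mvt_very_simple)
      fix u assume "t \<le> u" "u \<le> t + \<tau>"
      then show "(F has_derivative (*) (F' u)) (at u within {t..t + \<tau>})"
        using der[of u] ta
        by (auto simp: has_field_derivative_def intro: has_derivative_subset)
    qed (use tau in simp)
    then obtain u where u: "u \<in> {t..t + \<tau>}" "F (t + \<tau>) - F t = F' u * \<tau>" by auto
    then have "F (t + \<tau>) - F t \<ge> \<mu> * \<tau>" using big[of u] tau by auto
    moreover have "F t \<ge> F T" using mono T that by auto
    ultimately show False using T up[of "t + \<tau>"] ta tau by auto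
  qed
  then show "\<forall>\<^sub>F t in at_top. dist (q t) 0 < e"
    unfolding eventually_at_top_linorder by (intro exI[of _ T]) auto
qed

text \<open>The set is a Lipschitz image of a subset of a hyperplane, so no measurability is needed.\<close>

lemma negligible_of_inverse_Lipschitz_into_hyperplane:
  fixes \<phi> :: "'a::euclidean_space \<Rightarrow> 'a"
  assumes "e \<noteq> 0" and hyp: "\<And>z. z \<in> N \<Longrightarrow> e \<bullet> \<phi> z = 0"
    and lip: "\<And>z w. z \<in> N \<Longrightarrow> w \<in> N \<Longrightarrow> norm (z - w) \<le> C * norm (\<phi> z - \<phi> w)"
  shows "negligible N"
proof -
  have inj: "inj_on \<phi> N"
  proof (rule inj_onI)
    fix z w assume "z \<in> N" "w \<in> N" "\<phi> z = \<phi> w"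
    then show "z = w" using lip[of z w] by simp
  qed
  have "negligible (inv_into N \<phi> ` (\<phi> ` N))"
  proof (rule negligible_locally_Lipschitz_image)
    show "negligible (\<phi> ` N)"
      using assms(1) hyp by (intro negligible_subset[OF negligible_hyperplane[of e 0]]) auto
    fix x assume "x \<in> \<phi> ` N"
    then show "\<exists>T B. open T \<and> x \<in> T \<and>
       (\<forall>y\<in>\<phi> ` N \<inter> T. norm (inv_into N \<phi> y - inv_into N \<phi> x) \<le> B * norm (y - x))"
      using lip inj by (intro exI[of _ UNIV] exI[of _ C]) auto
  qed simp
  then show ?thesis using inj by simp
qed

section \<open>Symmetry of the Hessian and Lipschitz bounds for the gradient\<close>

lemma second_difference_estimate:
  fixes f :: "real^'n \<Rightarrow> real"
  assumes f: "\<And>x. (f has_derivative (\<lambda>h. g x \<bullet> h)) (at x)"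
    and g: "\<And>y. norm (y - x) < r \<Longrightarrow> norm (g y - g x - A *v (y - x)) \<le> e * norm (y - x)"
    and s: "s > 0" "s * (norm a + norm b) < r" and "e \<ge> 0"
  shows "\<bar>(f (x + s *\<^sub>R a + s *\<^sub>R b) - f (x + s *\<^sub>R a) - f (x + s *\<^sub>R b) + f x) - s\<^sup>2 * (a \<bullet> (A *v b))\<bar>
     \<le> 2 * e * s\<^sup>2 * (norm a + norm b)\<^sup>2"
proof -
  \<comment> \<open>\<open>\<phi>\<close> moves the increment of \<open>f\<close> in direction
    \<open>b\<close> along \<open>a\<close>. The mean value theorem turns the second difference into
    a difference of gradients at two points, and both gradients are linearised at
    \<open>x\<close>.\<close>
  define \<phi> where "\<phi> t = f (x + (t * s) *\<^sub>R a + s *\<^sub>R b) - f (x + (t * s) *\<^sub>R a)" for t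
  let ?g = "\<lambda>t. g (x + (t * s) *\<^sub>R a + s *\<^sub>R b) - g (x + (t * s) *\<^sub>R a)"
  have "\<exists>t\<in>{0..1}. \<phi> 1 - \<phi> 0 = (\<lambda>h. ?g t \<bullet> ((h * s) *\<^sub>R a)) (1 - 0)"
  proof (rule mvt_very_simple)
    show "(\<phi> has_derivative (\<lambda>h. ?g t \<bullet> ((h * s) *\<^sub>R a))) (at t within {0..1})" for t
      unfolding \<phi>_def
      by (auto intro!: derivative_eq_intros has_derivative_compose[OF _ f] simp: inner_diff_left right_diff_distrib)
  qed simp
  then obtain t where t: "0 \<le> t" "t \<le> 1" and eq: "\<phi> 1 - \<phi> 0 = ?g t \<bullet> (s *\<^sub>R a)" by auto
  let ?y = "x + (t * s) *\<^sub>R a + s *\<^sub>R b" and ?z = "x + (t * s) *\<^sub>R a"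
  let ?R = "s * (norm a + norm b)"
  have ts: "\<bar>t * s\<bar> \<le> s" using t s by (simp add: abs_mult mult_left_le_one_le)
  have nz: "norm (?z - x) \<le> s * norm a"
    using ts by (simp add: mult_right_mono)
  have "norm (?y - x) \<le> norm ((t * s) *\<^sub>R a) + norm (s *\<^sub>R b)"
    using norm_triangle_ineq[of "(t * s) *\<^sub>R a" "s *\<^sub>R b"] by (simp add: add.assoc)
  also have "\<dots> \<le> ?R" using nz s by (simp add: distrib_left)
  finally have ny: "norm (?y - x) \<le> ?R" .
  have nz': "norm (?z - x) \<le> ?R" using nz s by (smt (verit) distrib_left norm_ge_zero zero_le_mult_iff)
  have "norm (?g t - A *v (s *\<^sub>R b)) = norm ((g ?y - g x - A *v (?y - x)) - (g ?z - g x - A *v (?z - x)))"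
    by (simp add: algebra_simps matrix_vector_right_distrib)
  also have "\<dots> \<le> e * norm (?y - x) + e * norm (?z - x)"
    using g[of ?y] g[of ?z] ny nz' s norm_triangle_ineq4 by (smt (verit))
  also have "\<dots> \<le> e * ?R + e * ?R"
    using ny nz' \<open>e \<ge> 0\<close> by (intro add_mono mult_left_mono) auto
  finally have 1: "norm (?g t - A *v (s *\<^sub>R b)) \<le> 2 * e * ?R" by simp
  have "(\<phi> 1 - \<phi> 0) - s\<^sup>2 * (a \<bullet> (A *v b)) = (?g t - A *v (s *\<^sub>R b)) \<bullet> (s *\<^sub>R a)"
    unfolding eq
    by (simp add: inner_diff_left power2_eq_square matrix_vector_mult_scaleR inner_commute[of a] right_diff_distrib)
  also have "\<bar>\<dots>\<bar> \<le> (2 * e * ?R) * norm (s *\<^sub>R a)"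
    using 1 Cauchy_Schwarz_ineq2 by (meson mult_right_mono norm_ge_zero order_trans)
  also have "\<dots> \<le> (2 * e * ?R) * ?R"
    using s \<open>e \<ge> 0\<close> by (intro mult_left_mono) (auto simp: distrib_left)
  finally show ?thesis
    unfolding \<phi>_def by (simp add: power2_eq_square algebra_simps)
qed

text \<open>Schwarz's theorem: the second difference of \<open>f\<close> is unchanged when
  \<open>a\<close> and \<open>b\<close> change places and, divided by \<open>s\<^sup>2\<close>,
  approximates both sides of the identity to any accuracy.\<close>

lemma C2_grad_hess_symmetric:
  assumes "C2_grad_hess f g H"
  shows "a \<bullet> (H x *v b) = b \<bullet> (H x *v a)"
proof -
  have f: "(f has_derivative (\<lambda>h. g x \<bullet> h)) (at x)"
    and g: "(g has_derivative (\<lambda>h. H x *v h)) (at x)" for x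
    using assms by (auto simp: C2_grad_hess_def)
  let ?M = "(norm a + norm b)\<^sup>2"
  have "\<bar>a \<bullet> (H x *v b) - b \<bullet> (H x *v a)\<bar> \<le> e * (4 * ?M)" if "e > 0" for e
  proof -
    obtain r where r: "r > 0" "\<And>y. norm (y - x) < r \<Longrightarrow> norm (g y - g x - H x *v (y - x)) \<le> e * norm (y - x)"
      using g[of x] \<open>e > 0\<close> unfolding has_derivative_at_alt by blast
    \<comment> \<open>The summand 1 makes \<open>s * (norm a + norm b) < r\<close> strict and covers
      \<open>a = b = 0\<close>.\<close>
    define s where "s = r / (norm a + norm b + 1)"
    have n: "norm a + norm b \<ge> 0" by simp
    have s: "s > 0" unfolding s_def using r(1) n by (intro divide_pos_pos) linarith+
    have "s * (norm a + norm b) < s * (norm a + norm b + 1)" using s by simp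
    also have "\<dots> = r" using n by (simp add: s_def add_nonneg_eq_0_iff)
    finally have sr: "s * (norm a + norm b) < r" .
    have 1: "\<bar>(f (x + s *\<^sub>R a + s *\<^sub>R b) - f (x + s *\<^sub>R a) - f (x + s *\<^sub>R b) + f x) - s\<^sup>2 * (a \<bullet> (H x *v b))\<bar>
       \<le> 2 * e * s\<^sup>2 * ?M"
      using f r(2) s sr \<open>e > 0\<close> by (intro second_difference_estimate[of f g x r]) auto
    have 2: "\<bar>(f (x + s *\<^sub>R b + s *\<^sub>R a) - f (x + s *\<^sub>R b) - f (x + s *\<^sub>R a) + f x) - s\<^sup>2 * (b \<bullet> (H x *v a))\<bar>
       \<le> 2 * e * s\<^sup>2 * (norm b + norm a)\<^sup>2"
      using f r(2) s sr \<open>e > 0\<close> by (intro second_difference_estimate[of f g x r]) (auto simp: add.commute)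
    have c: "x + s *\<^sub>R b + s *\<^sub>R a = x + s *\<^sub>R a + s *\<^sub>R b" by (simp add: algebra_simps)
    have "\<bar>s\<^sup>2 * (a \<bullet> (H x *v b)) - s\<^sup>2 * (b \<bullet> (H x *v a))\<bar> \<le> 4 * e * s\<^sup>2 * ?M"
      using 1 2 unfolding c add.commute[of "norm b"] by linarith
    moreover have "s\<^sup>2 * \<bar>a \<bullet> (H x *v b) - b \<bullet> (H x *v a)\<bar>
        = \<bar>s\<^sup>2 * (a \<bullet> (H x *v b)) - s\<^sup>2 * (b \<bullet> (H x *v a))\<bar>"
      by (simp add: abs_mult flip: right_diff_distrib)
    ultimately have "s\<^sup>2 * \<bar>a \<bullet> (H x *v b) - b \<bullet> (H x *v a)\<bar> \<le> s\<^sup>2 * (e * (4 * ?M))"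
      by (simp add: mult_ac)
    then show ?thesis using s by simp
  qed
  note * = this
  have "\<bar>a \<bullet> (H x *v b) - b \<bullet> (H x *v a)\<bar> \<le> 0"
  proof (rule field_le_epsilon)
    fix e :: real assume "e > 0"
    have M: "4 * ?M + 1 > 0" by (simp add: add_nonneg_pos)
    have "\<bar>a \<bullet> (H x *v b) - b \<bullet> (H x *v a)\<bar> \<le> e / (4 * ?M + 1) * (4 * ?M)"
      using *[of "e / (4 * ?M + 1)"] M \<open>e > 0\<close> by simp
    also have "\<dots> \<le> e" using M \<open>e > 0\<close> by (simp add: field_simps)
    finally show "\<bar>a \<bullet> (H x *v b) - b \<bullet> (H x *v a)\<bar> \<le> 0 + e" by simp
  qed
  then show ?thesis by simp
qed

text \<open>Strict differentiability: \<open>y \<mapsto> g y - H p *v y\<close> has derivative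
  \<open>H u - H p\<close>, which is small on a ball by continuity of \<open>H\<close>, and the ball
  is convex. Both points vary because two trajectories near \<open>p\<close> are to be
  compared.\<close>

lemma C2_grad_Lipschitz_near:
  fixes f :: "real^'n \<Rightarrow> real"
  assumes "C2_grad_hess f g H" and "e > 0"
  obtains r where "r > 0"
    "\<And>y z. y \<in> ball p r \<Longrightarrow> z \<in> ball p r \<Longrightarrow> norm (g y - g z - H p *v (y - z)) \<le> e * norm (y - z)"
proof -
  have g: "(g has_derivative (\<lambda>h. H x *v h)) (at x)" for x
    using assms by (auto simp: C2_grad_hess_def)
  have "isCont H p" using assms by (auto simp: C2_grad_hess_def continuous_on_eq_continuous_at)
  then obtain r where r: "r > 0" "\<And>y. dist y p < r \<Longrightarrow> dist (H y) (H p) < e"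
    using \<open>e > 0\<close> unfolding continuous_at by (metis continuous_at_eps_delta \<open>isCont H p\<close>)
  show thesis
  proof (rule that[OF r(1)])
    fix y z assume "y \<in> ball p r" "z \<in> ball p r"
    then have "norm ((g y - H p *v y) - (g z - H p *v z)) \<le> e * norm (y - z)"
    proof (intro differentiable_bound[of "ball p r" _ "\<lambda>u h. H u *v h - H p *v h"])
      fix u assume u: "u \<in> ball p r"
      show "((\<lambda>y. g y - H p *v y) has_derivative (\<lambda>h. H u *v h - H p *v h)) (at u within ball p r)"
        by (intro has_derivative_diff has_derivative_at_withinI[OF g]
            bounded_linear.has_derivative[OF matrix_vector_mul_bounded_linear] has_derivative_ident)
      show "onorm (\<lambda>h. H u *v h - H p *v h) \<le> e"
      proof (rule onorm_le)
        fix h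
        have "norm (H u *v h - H p *v h) \<le> norm (H u - H p) * norm h"
          using norm_matrix_vector_mult_le[of "H u - H p" h]
          by (simp add: matrix_vector_mult_diff_rdistrib)
        also have "\<dots> \<le> e * norm h"
          using r(2)[of u] u by (intro mult_right_mono) (auto simp: dist_norm norm_minus_commute)
        finally show "norm (H u *v h - H p *v h) \<le> e * norm h" .
      qed
    qed auto
    then show "norm (g y - g z - H p *v (y - z)) \<le> e * norm (y - z)"
      by (simp add: matrix_vector_mult_diff_distrib algebra_simps)
  qed
qed

lemma C2_grad_Lipschitz_on_cball:
  fixes f :: "real^'n \<Rightarrow> real"
  assumes "C2_grad_hess f g H"
  obtains L where "L \<ge> 0"
    "\<And>y z. norm y \<le> R \<Longrightarrow> norm z \<le> R \<Longrightarrow> norm (g y - g z) \<le> L * norm (y - z)"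
proof -
  have g: "(g has_derivative (\<lambda>h. H x *v h)) (at x)" for x
    using assms by (auto simp: C2_grad_hess_def)
  have "compact (H ` cball 0 R)"
    using assms by (intro compact_continuous_image)
      (auto simp: C2_grad_hess_def intro: continuous_on_subset)
  then obtain L where L: "\<And>y. y \<in> cball 0 R \<Longrightarrow> norm (H y) \<le> L"
    using compact_imp_bounded[of "H ` cball 0 R"] by (fastforce simp: bounded_iff)
  show thesis
  \<comment> \<open>For \<open>R < 0\<close> the ball is empty and nothing forces \<open>L\<close>
    to be nonnegative.\<close>
  proof (rule that[of "max L 0"])
    fix y z :: "real^'n" assume "norm y \<le> R" "norm z \<le> R"
    then show "norm (g y - g z) \<le> max L 0 * norm (y - z)"
    proof (intro differentiable_bound[of "cball 0 R" g "\<lambda>u h. H u *v h"])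
      fix u :: "real^'n" assume u: "u \<in> cball 0 R"
      show "onorm (\<lambda>h. H u *v h) \<le> max L 0"
      proof (rule onorm_le)
        fix h
        have "norm (H u) \<le> max L 0" using L[OF u] by simp
        then show "norm (H u *v h) \<le> max L 0 * norm h"
          using norm_matrix_vector_mult_le[of "H u" h]
          by (meson mult_right_mono norm_ge_zero order_trans)
      qed
    qed (auto intro: has_derivative_at_withinI[OF g])
  qed simp
qed

lemma invertible_matrix_bounded_below:
  fixes A :: "real^'n^'n"
  assumes "invertible A"
  obtains m where "m > 0" "\<And>v. m * norm v \<le> norm (A *v v)"
  using linear_inj_bounded_below_pos[OF matrix_vector_mul_linear inj_matrix_vector_mult[OF assms]]
  by blast

section \<open>Bounded trajectories\<close>

locale inertial_morse =
  fixes f :: "real^'n \<Rightarrow> real" and g :: "real^'n \<Rightarrow> real^'n"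
    and H :: "real^'n \<Rightarrow> real^'n^'n" and c \<beta> :: real
  assumes c_pos: "c > 0" and beta: "0 < \<beta>" "\<beta> < 2 / c"
    and C2: "C2_grad_hess f g H" and inf: "bdd_below (range f)"
    and Morse: "morse g H"
begin

lemma grad: "(f has_derivative (\<lambda>h. g x \<bullet> h)) (at x)"
  using C2 by (simp add: C2_grad_hess_def)

lemma continuous_on_g: "continuous_on S g"
  using C2 by (auto simp: C2_grad_hess_def intro!: continuous_at_imp_continuous_on has_derivative_continuous)

lemma continuous_on_f: "continuous_on S f"
  using grad by (auto intro!: continuous_at_imp_continuous_on has_derivative_continuous)

lemma solution_derivatives:
  assumes "is_solution g c \<beta> x0 v0 x v" "t \<ge> 0"
  shows "(x has_vector_derivative v t) (at t within {0..})"
    and "(v has_vector_derivative - (c *\<^sub>R v t + g (x t + \<beta> *\<^sub>R v t))) (at t within {0..})"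
proof -
  show "(x has_vector_derivative v t) (at t within {0..})"
    using assms by (auto simp: is_solution_def)
  obtain a where "(v has_vector_derivative a) (at t within {0..})"
      "a + c *\<^sub>R v t + g (x t + \<beta> *\<^sub>R v t) = 0"
    using assms by (auto simp: is_solution_def)
  moreover from this have "a = - (c *\<^sub>R v t + g (x t + \<beta> *\<^sub>R v t))"
    by (simp only: eq_neg_iff_add_eq_0 add.assoc)
  ultimately show "(v has_vector_derivative - (c *\<^sub>R v t + g (x t + \<beta> *\<^sub>R v t))) (at t within {0..})"
    by simp
qed

text \<open>Here the upper bound on \<open>\<beta>\<close> enters: for
  \<open>\<beta> * c < 2\<close> the quadratic form stays nonnegative after a quarter of its
  diagonal part is subtracted. It is applied to gradient and velocity of one solution, and later to
  the linearised difference of two.\<close>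

lemma dissipation_ge:
  fixes u w :: "real^'n"
  shows "\<beta> * (norm u)\<^sup>2 + \<beta> * c * (w \<bullet> u) + c * (norm w)\<^sup>2 \<ge> (\<beta> * (norm u)\<^sup>2 + c * (norm w)\<^sup>2) / 4"
proof -
  have bc: "\<beta> * c < 2" using beta c_pos by (simp add: pos_less_divide_eq)
  have "\<beta> * c * (w \<bullet> u) \<ge> - (\<beta> * c * (norm w * norm u))"
    using Cauchy_Schwarz_ineq2[of w u] beta c_pos
    by (metis abs_le_D2 minus_le_iff mult_left_mono mult_minus_right mult_pos_pos less_imp_le)
  \<comment> \<open>Completing the square in \<open>norm u\<close>; the last coefficient is positive
    because \<open>\<beta> * c / 3 < 2 / 3\<close>.\<close>
  moreover have "3 / 4 * (\<beta> * (norm u)\<^sup>2 + c * (norm w)\<^sup>2) - \<beta> * c * (norm w * norm u)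
      = 3 / 4 * \<beta> * (norm u - 2 / 3 * c * norm w)\<^sup>2 + (norm w)\<^sup>2 * c * (3 / 4 - \<beta> * c / 3)"
    by (simp add: power2_eq_square algebra_simps)
  moreover have "\<dots> \<ge> 0"
    using bc beta c_pos by (intro add_nonneg_nonneg mult_nonneg_nonneg) auto
  ultimately show ?thesis by (simp add: algebra_simps)
qed

text \<open>The products of velocity and gradient coming from the motion of \<open>x\<close> and
  from the kinetic term cancel. The motion of \<open>\<beta> *\<^sub>R v t\<close> inside
  \<open>f\<close> contributes the squared gradient and the remaining mixed term.\<close>

lemma energy_derivative:
  assumes "is_solution g c \<beta> x0 v0 x v" "t \<ge> 0"
  shows "((\<lambda>t. f (x t + \<beta> *\<^sub>R v t) + (norm (v t))\<^sup>2 / 2) has_real_derivative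
     - (\<beta> * (norm (g (x t + \<beta> *\<^sub>R v t)))\<^sup>2 + \<beta> * c * (v t \<bullet> g (x t + \<beta> *\<^sub>R v t)) + c * (norm (v t))\<^sup>2))
     (at t within {0..})"
proof -
  let ?u = "g (x t + \<beta> *\<^sub>R v t)"
  have x: "(x has_derivative (\<lambda>h. h *\<^sub>R v t)) (at t within {0..})"
    and v: "(v has_derivative (\<lambda>h. h *\<^sub>R - (c *\<^sub>R v t + ?u))) (at t within {0..})"
    using solution_derivatives[OF assms] by (auto simp: has_vector_derivative_def)
  have y: "((\<lambda>t. x t + \<beta> *\<^sub>R v t) has_derivative
      (\<lambda>h. h *\<^sub>R v t + \<beta> *\<^sub>R (h *\<^sub>R - (c *\<^sub>R v t + ?u)))) (at t within {0..})"
    by (intro derivative_intros x v)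
  have "((\<lambda>t. f (x t + \<beta> *\<^sub>R v t) + (v t \<bullet> v t) / 2) has_derivative
     (\<lambda>h. ?u \<bullet> (h *\<^sub>R v t + \<beta> *\<^sub>R (h *\<^sub>R - (c *\<^sub>R v t + ?u))) +
       (v t \<bullet> (h *\<^sub>R - (c *\<^sub>R v t + ?u)) + (h *\<^sub>R - (c *\<^sub>R v t + ?u)) \<bullet> v t) / 2)) (at t within {0..})"
    by (intro has_derivative_add has_derivative_compose[OF y grad]
        bounded_linear.has_derivative[OF bounded_linear_divide] has_derivative_inner v)
  then show ?thesis
    unfolding has_field_derivative_def power2_norm_eq_inner
    by (rule has_derivative_eq_rhs)
      (auto simp: fun_eq_iff inner_add_right inner_add_left inner_diff_right inner_commute
        add_divide_distrib diff_divide_distrib algebra_simps)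
qed

text \<open>By nondegeneracy \<open>H p\<close> is bounded below, and near \<open>p\<close> the
  gradient deviates from its linearisation by at most half of that bound. The first estimate
  isolates \<open>p\<close> among the zeros of \<open>g\<close>; both together give a Lojasiewicz
  inequality with exponent 1/2.\<close>

lemma critical_point_estimates:
  assumes "critical_point g p"
  obtains r m M where "r > 0" "m > 0" "M > 0"
    "\<And>y. y \<in> ball p r \<Longrightarrow> m * norm (y - p) \<le> norm (g y)"
    "\<And>y. y \<in> ball p r \<Longrightarrow> \<bar>f y - f p\<bar> \<le> M * (norm (y - p))\<^sup>2"
proof -
  have gp: "g p = 0" using assms by (simp add: critical_point_def)
  obtain m where m: "m > 0" "\<And>v. m * norm v \<le> norm (H p *v v)"
    using Morse assms invertible_matrix_bounded_below by (metis morse_def)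
  obtain r where r: "r > 0"
    "\<And>y z. y \<in> ball p r \<Longrightarrow> z \<in> ball p r \<Longrightarrow> norm (g y - g z - H p *v (y - z)) \<le> m / 2 * norm (y - z)"
    using C2_grad_Lipschitz_near[OF C2, of "m / 2"] m by (metis half_gt_zero)
  have lin: "norm (g y - H p *v (y - p)) \<le> m / 2 * norm (y - p)" if "y \<in> ball p r" for y
    using r(2)[OF that, of p] r(1) gp by simp
  define M where "M = norm (H p) + m"
  have M: "M > 0" using m by (simp add: M_def add_nonneg_pos)
  have up: "norm (g y) \<le> M * norm (y - p)" if "y \<in> ball p r" for y
  proof -
    have "norm (g y) \<le> norm (g y - H p *v (y - p)) + norm (H p *v (y - p))"
      using norm_triangle_ineq[of "g y - H p *v (y - p)" "H p *v (y - p)"] by simp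
    also have "\<dots> \<le> m / 2 * norm (y - p) + norm (H p) * norm (y - p)"
      using lin[OF that] norm_matrix_vector_mult_le by (intro add_mono) auto
    also have "\<dots> \<le> M * norm (y - p)" using m by (simp add: M_def algebra_simps)
    finally show ?thesis .
  qed
  show thesis
  proof (rule that[of r "m / 2" M])
    fix y assume y: "y \<in> ball p r"
    have "norm (H p *v (y - p)) \<le> norm (g y) + norm (g y - H p *v (y - p))"
      using norm_triangle_ineq4[of "g y" "g y - H p *v (y - p)"] by simp
    then show "m / 2 * norm (y - p) \<le> norm (g y)"
      using m(2)[of "y - p"] lin[OF y] by simp
    \<comment> \<open>On the segment from \<open>p\<close> to \<open>y\<close> the gradient is at
      most \<open>M * norm (y - p)\<close>, so the increment of \<open>f\<close> is of second
      order.\<close>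
    let ?z = "\<lambda>t. p + t *\<^sub>R (y - p)"
    have "\<exists>t\<in>{0..1}. f (?z 1) - f (?z 0) = (\<lambda>h. g (?z t) \<bullet> (h *\<^sub>R (y - p))) (1 - 0)"
    proof (rule mvt_very_simple)
      show "((\<lambda>t. f (?z t)) has_derivative (\<lambda>h. g (?z t) \<bullet> (h *\<^sub>R (y - p)))) (at t within {0..1})" for t
        by (rule has_derivative_compose[OF _ grad]) (auto intro!: derivative_eq_intros)
    qed simp
    then obtain t where t: "0 \<le> t" "t \<le> 1" "f y - f p = g (?z t) \<bullet> (y - p)" by auto
    have tz: "norm (?z t - p) \<le> norm (y - p)" using t by (simp add: mult_left_le_one_le)
    then have zb: "?z t \<in> ball p r" using y by (simp add: dist_norm norm_minus_commute)
    have "\<bar>f y - f p\<bar> \<le> norm (g (?z t)) * norm (y - p)"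
      unfolding t(3) by (rule Cauchy_Schwarz_ineq2)
    also have "\<dots> \<le> (M * norm (y - p)) * norm (y - p)"
      using up[OF zb] tz M by (intro mult_right_mono) (auto intro: order_trans mult_left_mono)
    finally show "\<bar>f y - f p\<bar> \<le> M * (norm (y - p))\<^sup>2" by (simp add: power2_eq_square mult_ac)
  qed (use r m M in auto)
qed

end

locale bounded_trajectory = inertial_morse +
  fixes x0 v0 :: "real^'n" and x v :: "real \<Rightarrow> real^'n"
  assumes sol: "is_solution g c \<beta> x0 v0 x v" and bdd: "bounded (x ` {0..})"
begin

definition "y t = x t + \<beta> *\<^sub>R v t"

definition "E t = f (y t) + (norm (v t))\<^sup>2 / 2"

definition "D t = \<beta> * (norm (g (y t)))\<^sup>2 + \<beta> * c * (v t \<bullet> g (y t)) + c * (norm (v t))\<^sup>2"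

lemma E_derivative: "t \<ge> 0 \<Longrightarrow> (E has_real_derivative - D t) (at t within {0..})"
  using energy_derivative[OF sol] unfolding E_def[abs_def] D_def y_def by auto

lemma D_ge: "D t \<ge> \<beta> / 4 * (norm (g (y t)))\<^sup>2 + c / 4 * (norm (v t))\<^sup>2"
  using dissipation_ge[of "g (y t)" "v t"] unfolding D_def by (simp add: field_simps)

lemma D_ge_g: "D t \<ge> \<beta> / 4 * (norm (g (y t)))\<^sup>2"
proof -
  have "c / 4 * (norm (v t))\<^sup>2 \<ge> 0" using c_pos by simp
  then show ?thesis using D_ge[of t] by linarith
qed

lemma D_ge_v: "D t \<ge> c / 4 * (norm (v t))\<^sup>2"
proof -
  have "\<beta> / 4 * (norm (g (y t)))\<^sup>2 \<ge> 0" using beta by simp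
  then show ?thesis using D_ge[of t] by linarith
qed

lemma D_nonneg: "D t \<ge> 0"
proof -
  have "c / 4 * (norm (v t))\<^sup>2 \<ge> 0" using c_pos by simp
  then show ?thesis using D_ge_v[of t] by linarith
qed

lemma E_antimono: "0 \<le> s \<Longrightarrow> s \<le> t \<Longrightarrow> E t \<le> E s"
  using has_real_derivative_nonneg_mono_atLeast[of 0 "\<lambda>t. - E t" D s t] D_nonneg
    DERIV_minus[OF E_derivative] by simp

lemma continuous_on_x: "continuous_on {0..} x"
  using solution_derivatives(1)[OF sol] by (auto simp: continuous_on_eq_continuous_within intro: has_vector_derivative_continuous)

lemma continuous_on_v: "continuous_on {0..} v"
  using solution_derivatives(2)[OF sol] by (auto simp: continuous_on_eq_continuous_within intro: has_vector_derivative_continuous)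

lemma E_bounded_below: obtains m where "\<And>t. E t \<ge> m"
proof -
  obtain m where "\<And>z. f z \<ge> m" using inf by (auto simp: bdd_below_def)
  then show thesis using that[of m] unfolding E_def by (smt (verit) divide_nonneg_nonneg zero_le_power2)
qed

lemma bounds:
  obtains R where "\<And>t. t \<ge> 0 \<Longrightarrow> norm (x t) \<le> R" "\<And>t. t \<ge> 0 \<Longrightarrow> norm (v t) \<le> R"
    "\<And>t. t \<ge> 0 \<Longrightarrow> norm (y t) \<le> R"
proof -
  obtain m where m: "\<And>z. f z \<ge> m" using inf by (auto simp: bdd_below_def)
  obtain B where B: "\<And>t. t \<ge> 0 \<Longrightarrow> norm (x t) \<le> B" using bdd by (auto simp: bounded_iff)
  \<comment> \<open>The kinetic energy never exceeds \<open>E 0 - m\<close>, because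
    \<open>E\<close> decreases and \<open>f\<close> stays above \<open>m\<close>.\<close>
  define S where "S = sqrt (2 * (E 0 - m))"
  have S: "norm (v t) \<le> S" if "t \<ge> 0" for t
  proof -
    have "(norm (v t))\<^sup>2 \<le> 2 * (E 0 - m)"
      using E_antimono[OF _ that] m[of "y t"] by (simp add: E_def)
    then show ?thesis unfolding S_def by (rule real_le_rsqrt)
  qed
  have B0: "B \<ge> 0" "S \<ge> 0" using B[of 0] S[of 0] norm_ge_zero order_trans by (blast intro: order_refl)+
  show thesis
  proof (rule that[of "B + S + \<beta> * S"])
    fix t :: real assume t: "t \<ge> 0"
    have bS: "\<beta> * S \<ge> 0" using beta B0 by simp
    show "norm (x t) \<le> B + S + \<beta> * S" "norm (v t) \<le> B + S + \<beta> * S"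
      using B[OF t] S[OF t] B0 bS by linarith+
    have "norm (y t) \<le> norm (x t) + norm (\<beta> *\<^sub>R v t)" unfolding y_def by (rule norm_triangle_ineq)
    also have "norm (\<beta> *\<^sub>R v t) \<le> \<beta> * S" using S[OF t] beta by simp
    finally show "norm (y t) \<le> B + S + \<beta> * S" using B[OF t] B0 by linarith
  qed
qed

text \<open>The trajectory stays in a ball on which \<open>g\<close> is Lipschitz, so the
  acceleration is bounded and both \<open>v\<close> and \<open>g \<circ> y\<close> are Lipschitz in
  time. Barbalat's argument then applies with the increasing bounded function \<open>- E\<close> and
  its derivative \<open>D\<close>.\<close>

lemma velocity_and_gradient_tendsto_0:
  shows "(v \<longlongrightarrow> 0) at_top" and "((\<lambda>t. g (y t)) \<longlongrightarrow> 0) at_top"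
proof -
  obtain R where R: "\<And>t. t \<ge> 0 \<Longrightarrow> norm (x t) \<le> R" "\<And>t. t \<ge> 0 \<Longrightarrow> norm (v t) \<le> R"
    "\<And>t. t \<ge> 0 \<Longrightarrow> norm (y t) \<le> R" by (rule bounds) blast
  have R0: "R \<ge> 0" using R(1)[of 0] norm_ge_zero order_trans by blast
  obtain L where L: "L \<ge> 0" "\<And>y z. norm y \<le> R \<Longrightarrow> norm z \<le> R \<Longrightarrow> norm (g y - g z) \<le> L * norm (y - z)"
    using C2_grad_Lipschitz_on_cball[OF C2] by blast
  define G where "G = norm (g 0) + L * R"
  have G: "norm (g (y t)) \<le> G" if "t \<ge> 0" for t
  proof -
    have "norm (g (y t)) \<le> norm (g 0) + norm (g (y t) - g 0)"
      using norm_triangle_ineq[of "g 0" "g (y t) - g 0"] by simp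
    also have "norm (g (y t) - g 0) \<le> L * norm (y t - 0)" by (rule L(2)) (use R(3)[OF that] R0 in auto)
    also have "\<dots> \<le> L * R" using L(1) R(3)[OF that] by (simp add: mult_left_mono)
    finally show ?thesis by (simp add: G_def)
  qed
  let ?a = "\<lambda>t. - (c *\<^sub>R v t + g (y t))"
  have a: "norm (?a t) \<le> c * R + G" if "t \<ge> 0" for t
  proof -
    have "norm (?a t) \<le> norm (c *\<^sub>R v t) + norm (g (y t))"
      using norm_triangle_ineq[of "c *\<^sub>R v t" "g (y t)"] by (simp only: norm_minus_cancel)
    also have "\<dots> \<le> c * R + G" using R(2)[OF that] G[OF that] c_pos by (intro add_mono) auto
    finally show ?thesis .
  qed
  have dv: "(v has_vector_derivative ?a t) (at t within {0..})" if "t \<ge> 0" for t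
    using solution_derivatives(2)[OF sol that] by (simp add: y_def)
  have lipv: "norm (v t - v s) \<le> (c * R + G) * \<bar>t - s\<bar>" if "0 \<le> s" "0 \<le> t" for s t
    by (rule has_vector_derivative_norm_bound_atLeast[OF dv a that])
  have lipx: "norm (x t - x s) \<le> R * \<bar>t - s\<bar>" if "0 \<le> s" "0 \<le> t" for s t
    by (rule has_vector_derivative_norm_bound_atLeast[OF solution_derivatives(1)[OF sol] R(2) that])
  define K where "K = R + \<beta> * (c * R + G)"
  have lipy: "norm (y t - y s) \<le> K * \<bar>t - s\<bar>" if "0 \<le> s" "0 \<le> t" for s t
  proof -
    have "norm (y t - y s) \<le> norm (x t - x s) + norm (\<beta> *\<^sub>R (v t - v s))"
      using norm_triangle_ineq[of "x t - x s" "\<beta> *\<^sub>R (v t - v s)"] by (simp add: y_def algebra_simps)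
    also have "norm (\<beta> *\<^sub>R (v t - v s)) \<le> \<beta> * ((c * R + G) * \<bar>t - s\<bar>)"
      using lipv[OF that] beta by simp
    finally show ?thesis using lipx[OF that] unfolding K_def by (simp add: algebra_simps)
  qed
  have lipg: "norm (g (y t) - g (y s)) \<le> (L * K) * \<bar>t - s\<bar>" if "0 \<le> s" "0 \<le> t" for s t
  proof -
    have "norm (g (y t) - g (y s)) \<le> L * norm (y t - y s)" using L(2) R(3) that by auto
    also have "\<dots> \<le> L * (K * \<bar>t - s\<bar>)" using lipy[OF that] L(1) by (rule mult_left_mono)
    finally show ?thesis by (simp add: mult.assoc)
  qed
  obtain m where m: "\<And>t. E t \<ge> m" by (rule E_bounded_below) blast
  have dE: "((\<lambda>t. - E t) has_real_derivative D t) (at t within {0..})" if "t \<ge> 0" for t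
    using that by (auto intro!: derivative_eq_intros E_derivative)
  show "(v \<longlongrightarrow> 0) at_top"
    by (rule tendsto_zero_of_square_le_derivative[OF dE D_ge_v, where B="- m"]) (use c_pos m lipv in auto)
  show "((\<lambda>t. g (y t)) \<longlongrightarrow> 0) at_top"
    by (rule tendsto_zero_of_square_le_derivative[OF dE D_ge_g, where B="- m"]) (use beta m lipg in auto)
qed

text \<open>Transfer from \<open>y\<close> to \<open>x\<close>: the two points differ by
  \<open>\<beta> * norm (v t)\<close> and \<open>g\<close> is Lipschitz on the ball containing them,
  so the gradient at \<open>x t\<close> is controlled by quantities that \<open>D\<close>
  dominates.\<close>

lemma gradient_square_integrable_and_vanishing:
  shows "set_integrable lborel {0..} (\<lambda>t. (norm (g (x t)))\<^sup>2)"
    and "((\<lambda>t. g (x t)) \<longlongrightarrow> 0) at_top"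
proof -
  obtain R where R: "\<And>t. t \<ge> 0 \<Longrightarrow> norm (x t) \<le> R" "\<And>t. t \<ge> 0 \<Longrightarrow> norm (v t) \<le> R"
    "\<And>t. t \<ge> 0 \<Longrightarrow> norm (y t) \<le> R" by (rule bounds) blast
  obtain L where L: "L \<ge> 0" "\<And>y z. norm y \<le> R \<Longrightarrow> norm z \<le> R \<Longrightarrow> norm (g y - g z) \<le> L * norm (y - z)"
    using C2_grad_Lipschitz_on_cball[OF C2] by blast
  have le: "norm (g (x t)) \<le> norm (g (y t)) + L * \<beta> * norm (v t)" if "t \<ge> 0" for t
  proof -
    have "norm (g (x t)) \<le> norm (g (y t)) + norm (g (x t) - g (y t))"
      using norm_triangle_ineq[of "g (y t)" "g (x t) - g (y t)"] by simp
    also have "norm (g (x t) - g (y t)) \<le> L * norm (x t - y t)" using L(2) R that by auto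
    also have "norm (x t - y t) = \<beta> * norm (v t)" using beta by (simp add: y_def)
    finally show ?thesis by (simp add: mult.assoc)
  qed
  have "((\<lambda>t. norm (g (y t)) + L * \<beta> * norm (v t)) \<longlongrightarrow> norm (0::real^'n) + L * \<beta> * norm (0::real^'n)) at_top"
    by (intro tendsto_intros velocity_and_gradient_tendsto_0)
  then have lim: "((\<lambda>t. norm (g (y t)) + L * \<beta> * norm (v t)) \<longlongrightarrow> 0) at_top" by simp
  show "((\<lambda>t. g (x t)) \<longlongrightarrow> 0) at_top"
  proof (rule Lim_null_comparison[OF _ lim])
    show "\<forall>\<^sub>F t in at_top. norm (g (x t)) \<le> norm (g (y t)) + L * \<beta> * norm (v t)"
      using eventually_ge_at_top[of "0::real"] by eventually_elim (rule le)
  qed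
  \<comment> \<open>Each coefficient is the 2 from the square of a sum times the factor 4 from
    \<open>D_ge_g\<close> or \<open>D_ge_v\<close>.\<close>
  define A where "A = 8 / \<beta> + 8 * (L * \<beta>)\<^sup>2 / c"
  have sq: "norm ((norm (g (x t)))\<^sup>2) \<le> A * D t" if "t \<ge> 0" for t
  proof -
    let ?u = "norm (g (y t))" and ?w = "L * \<beta> * norm (v t)"
    have "(norm (g (x t)))\<^sup>2 \<le> (?u + ?w)\<^sup>2" using le[OF that] by (intro power_mono) auto
    also have "\<dots> \<le> 2 * ?u\<^sup>2 + 2 * ?w\<^sup>2"
      using zero_le_power2[of "?u - ?w"] by (simp add: power2_sum power2_diff)
    also have "2 * ?u\<^sup>2 = 8 / \<beta> * (\<beta> / 4 * ?u\<^sup>2)" using beta by simp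
    also have "\<dots> \<le> 8 / \<beta> * D t" using D_ge_g[of t] beta by (intro mult_left_mono) auto
    also have "2 * ?w\<^sup>2 = 8 * (L * \<beta>)\<^sup>2 / c * (c / 4 * (norm (v t))\<^sup>2)"
      using c_pos by (simp add: power_mult_distrib)
    also have "\<dots> \<le> 8 * (L * \<beta>)\<^sup>2 / c * D t" using D_ge_v[of t] c_pos by (intro mult_left_mono) auto
    finally show ?thesis by (simp add: A_def algebra_simps)
  qed
  have A: "A \<ge> 0" using beta c_pos by (simp add: A_def)
  obtain m where m: "\<And>t. E t \<ge> m" by (rule E_bounded_below) blast
  show "set_integrable lborel {0..} (\<lambda>t. (norm (g (x t)))\<^sup>2)"
  proof (rule set_integrable_atLeast_dominated_by_derivative[where F="\<lambda>t. A * - E t" and F'="\<lambda>t. A * D t" and B="A * - m"])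
    show "continuous_on {0..} (\<lambda>t. (norm (g (x t)))\<^sup>2)"
      by (intro continuous_intros continuous_on_compose2[OF continuous_on_g continuous_on_x]) auto
    show "((\<lambda>t. A * - E t) has_real_derivative A * D t) (at t within {0..})" if "t \<ge> 0" for t
      using that by (auto intro!: derivative_eq_intros E_derivative)
    show "A * - E t \<le> A * - m" for t using m[of t] A by (intro mult_left_mono) auto
  qed (use sq in auto)
qed

text \<open>Near an isolated zero \<open>p\<close> of \<open>g\<close>, a small sphere about \<open>p\<close> carries no small values of \<open>g\<close>,
  so the trajectory is eventually unable to cross it.\<close>

lemma converges_to_critical_point:
  obtains p where "critical_point g p" "(x \<longlongrightarrow> p) at_top"
proof -
  \<comment> \<open>A limit point along integer times is the candidate; it is critical because
    \<open>g \<circ> x\<close> tends to 0.\<close>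
  have "bounded (range (\<lambda>n::nat. x (real n)))" using bdd by (rule bounded_subset) auto
  then obtain p \<sigma> where \<sigma>: "strict_mono (\<sigma> :: nat \<Rightarrow> nat)" "((\<lambda>n. x (real n)) \<circ> \<sigma>) \<longlonglongrightarrow> p"
    using bounded_imp_convergent_subsequence by blast
  have top: "filterlim (\<lambda>n. real (\<sigma> n)) at_top sequentially"
    using filterlim_compose[OF filterlim_real_sequentially filterlim_subseq[OF \<sigma>(1)]] .
  have xp: "(\<lambda>n. x (real (\<sigma> n))) \<longlonglongrightarrow> p" using \<sigma>(2) by (simp add: o_def)
  have "isCont g p" using continuous_on_g[of UNIV] by (simp add: continuous_on_eq_continuous_at)
  then have "(\<lambda>n. g (x (real (\<sigma> n)))) \<longlonglongrightarrow> g p" using xp by (rule isCont_tendsto_compose)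
  moreover have "(\<lambda>n. g (x (real (\<sigma> n)))) \<longlonglongrightarrow> 0"
    by (rule filterlim_compose[OF gradient_square_integrable_and_vanishing(2) top])
  ultimately have "g p = 0" by (rule LIMSEQ_unique)
  then have crit: "critical_point g p" by (simp add: critical_point_def)
  obtain r m where r: "r > 0" "m > 0" "\<And>y. y \<in> ball p r \<Longrightarrow> m * norm (y - p) \<le> norm (g y)"
    by (rule critical_point_estimates[OF crit]) blast
  have "(x \<longlongrightarrow> p) at_top"
  proof (rule tendstoI)
    fix e :: real assume "e > 0"
    \<comment> \<open>The sphere of radius \<open>\<rho>\<close> must lie inside
      \<open>ball p r\<close>, where \<open>norm (g y) \<ge> m * \<rho>\<close> holds on it.\<close>
    define \<rho> where "\<rho> = min e (r / 2)"
    have \<rho>: "\<rho> > 0" "\<rho> \<le> e" "\<rho> < r" using \<open>e > 0\<close> r by (auto simp: \<rho>_def)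
    have "\<forall>\<^sub>F t in at_top. norm (g (x t)) < m * \<rho>"
      using tendstoD[OF gradient_square_integrable_and_vanishing(2), of "m * \<rho>"] r \<rho> by simp
    then obtain T where T: "\<And>t. t \<ge> T \<Longrightarrow> norm (g (x t)) < m * \<rho>"
      by (auto simp: eventually_at_top_linorder)
    have off: "norm (x t - p) \<noteq> \<rho>" if "t \<ge> T" for t
    proof
      assume eq: "norm (x t - p) = \<rho>"
      then have "x t \<in> ball p r" using \<rho> by (simp add: dist_norm norm_minus_commute)
      then show False using r(3)[of "x t"] T[OF that] eq by simp
    qed
    have "\<forall>\<^sub>F n in sequentially. dist (x (real (\<sigma> n))) p < \<rho> \<and> real (\<sigma> n) \<ge> max T 0"
      using tendstoD[OF xp \<rho>(1)] top by (auto simp: filterlim_at_top eventually_conj_iff)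
    then obtain n where n: "dist (x (real (\<sigma> n))) p < \<rho>" "real (\<sigma> n) \<ge> max T 0"
      using eventually_happens'[OF sequentially_bot] by blast
    let ?s = "real (\<sigma> n)"
    \<comment> \<open>At time \<open>?s\<close> the trajectory is inside the sphere; getting out
      later would mean meeting it, against \<open>off\<close>.\<close>
    have "norm (x t - p) < \<rho>" if "t \<ge> ?s" for t
    proof (rule ccontr)
      assume "\<not> norm (x t - p) < \<rho>"
      moreover have "continuous_on {?s..t} (\<lambda>t. norm (x t - p))"
        using n by (intro continuous_intros continuous_on_subset[OF continuous_on_x]) auto
      ultimately obtain u where "?s \<le> u" "u \<le> t" "norm (x u - p) = \<rho>"
        using IVT'[of "\<lambda>t. norm (x t - p)" ?s \<rho> t] n \<open>t \<ge> ?s\<close> by (auto simp: dist_norm)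
      then show False using off[of u] n by simp
    qed
    then show "\<forall>\<^sub>F t in at_top. dist (x t) p < e"
      using \<rho> unfolding eventually_at_top_linorder dist_norm by (meson less_le_trans)
  qed
  then show thesis using crit that by blast
qed

text \<open>Nondegeneracy gives \<open>\<bar>f - f p\<bar> \<le> C \<bar>\<nabla>f\<bar>\<^sup>2\<close> near \<open>p\<close>, so the energy gap decays exponentially and
  the speed is square integrable against an exponentially growing weight.\<close>

lemma velocity_integrable: "set_integrable lborel {0..} v"
proof -
  obtain p where p: "critical_point g p" "(x \<longlongrightarrow> p) at_top" by (rule converges_to_critical_point)
  obtain r m M where est: "r > 0" "m > 0" "M > 0"
    "\<And>y. y \<in> ball p r \<Longrightarrow> m * norm (y - p) \<le> norm (g y)"
    "\<And>y. y \<in> ball p r \<Longrightarrow> \<bar>f y - f p\<bar> \<le> M * (norm (y - p))\<^sup>2"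
    by (rule critical_point_estimates[OF p(1)]) blast
  have "(y \<longlongrightarrow> p + \<beta> *\<^sub>R 0) at_top"
    unfolding y_def[abs_def] by (intro tendsto_intros p velocity_and_gradient_tendsto_0)
  then have yp: "(y \<longlongrightarrow> p) at_top" by simp
  have "isCont f p" using continuous_on_f[of UNIV] by (simp add: continuous_on_eq_continuous_at)
  then have "((\<lambda>t. f (y t)) \<longlongrightarrow> f p) at_top" using yp by (rule isCont_tendsto_compose)
  then have "(E \<longlongrightarrow> f p + (norm (0::real^'n))\<^sup>2 / 2) at_top"
    unfolding E_def[abs_def] by (intro tendsto_intros velocity_and_gradient_tendsto_0) auto
  then have Elim: "(E \<longlongrightarrow> f p) at_top" by simp
  have Ege: "E t \<ge> f p" if "t \<ge> 0" for t
  proof (rule tendsto_upperbound[OF Elim])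
    show "\<forall>\<^sub>F s in at_top. E s \<le> E t"
      using eventually_ge_at_top[of t] by eventually_elim (use that in \<open>auto intro: E_antimono\<close>)
  qed simp
  obtain T0 where T0: "\<And>t. t \<ge> T0 \<Longrightarrow> y t \<in> ball p r"
    using tendstoD[OF yp est(1)] by (auto simp: eventually_at_top_linorder dist_commute)
  define T where "T = max T0 0"
  have T: "T \<ge> 0" "\<And>t. t \<ge> T \<Longrightarrow> y t \<in> ball p r" using T0 by (auto simp: T_def)
  \<comment> \<open>The first summand pays for the gap of \<open>f\<close> through the gradient part
    of \<open>D\<close>, the second for the kinetic energy through its velocity part.\<close>
  define C where "C = M / m\<^sup>2 * (4 / \<beta>) + 2 / c"
  have C: "C > 0" using est beta c_pos by (simp add: C_def add_pos_pos)
  have gap: "E t - f p \<le> C * D t" if "t \<ge> T" for t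
  proof -
    have "(m * norm (y t - p))\<^sup>2 \<le> (norm (g (y t)))\<^sup>2"
      using est(4)[OF T(2)[OF that]] est(2) by (intro power_mono) auto
    then have "(norm (y t - p))\<^sup>2 \<le> (norm (g (y t)))\<^sup>2 / m\<^sup>2"
      using est(2) by (simp add: power_mult_distrib field_simps)
    then have "M * (norm (y t - p))\<^sup>2 \<le> M * ((norm (g (y t)))\<^sup>2 / m\<^sup>2)"
      using est(3) by (intro mult_left_mono) auto
    also have "\<dots> = M / m\<^sup>2 * (4 / \<beta>) * (\<beta> / 4 * (norm (g (y t)))\<^sup>2)" using beta by simp
    also have "\<dots> \<le> M / m\<^sup>2 * (4 / \<beta>) * D t"
      using D_ge_g[of t] est beta by (intro mult_left_mono) auto
    finally have 1: "f (y t) - f p \<le> M / m\<^sup>2 * (4 / \<beta>) * D t"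
      using est(5)[OF T(2)[OF that]] by linarith
    have "(norm (v t))\<^sup>2 / 2 = 2 / c * (c / 4 * (norm (v t))\<^sup>2)" using c_pos by simp
    also have "\<dots> \<le> 2 / c * D t" using D_ge_v[of t] c_pos by (intro mult_left_mono) auto
    finally show ?thesis using 1 by (simp add: E_def C_def algebra_simps)
  qed
  \<comment> \<open>With this rate, differentiating the weight \<open>exp (\<epsilon> * t)\<close>
    uses up at most half of \<open>D\<close>.\<close>
  define \<epsilon> where "\<epsilon> = 1 / (2 * C)"
  have \<epsilon>: "\<epsilon> > 0" "\<epsilon> * C = 1 / 2" using C by (auto simp: \<epsilon>_def)
  \<comment> \<open>The first term has derivative at least
    \<open>exp (\<epsilon> * t) * (norm (v t))\<^sup>2\<close>, the second exactly
    \<open>exp (- (\<epsilon> * t))\<close>. Their sum dominates \<open>norm (v t)\<close>, while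
    \<open>F\<close> itself stays below 0.\<close>
  define F where "F t = - (8 / c) * (exp (\<epsilon> * t) * (E t - f p)) - exp (- (\<epsilon> * t)) / \<epsilon>" for t
  define F' where "F' t = (8 / c) * (exp (\<epsilon> * t) * (D t - \<epsilon> * (E t - f p))) + exp (- (\<epsilon> * t))" for t
  have "set_integrable lborel {T..} v"
  proof (rule set_integrable_atLeast_dominated_by_derivative[of T v F F' 0])
    show "continuous_on {T..} v" using T(1) by (auto intro: continuous_on_subset[OF continuous_on_v])
    fix t assume t: "t \<ge> T"
    have dE: "(E has_real_derivative - D t) (at t within {T..})"
      using E_derivative[of t] T(1) t by (auto intro: has_field_derivative_subset)
    show "(F has_real_derivative F' t) (at t within {T..})"
      unfolding F_def F'_def using \<epsilon>(1) c_pos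
      by (auto intro!: derivative_eq_intros dE simp: field_simps)
    have "exp (\<epsilon> * t) * (E t - f p) \<ge> 0" using Ege[of t] T(1) t by auto
    then show "F t \<le> 0" unfolding F_def using c_pos \<epsilon>(1)
      by (smt (verit, best) divide_nonneg_nonneg exp_ge_zero mult_minus_left mult_nonneg_nonneg)
    have "\<epsilon> * (E t - f p) \<le> \<epsilon> * (C * D t)" using gap[OF t] \<epsilon>(1) by (intro mult_left_mono) auto
    also have "\<dots> = D t / 2" using \<epsilon>(2) by (simp add: mult.assoc[symmetric])
    finally have "D t - \<epsilon> * (E t - f p) \<ge> c / 8 * (norm (v t))\<^sup>2" using D_ge_v[of t] by simp
    then have "(8 / c) * (exp (\<epsilon> * t) * (D t - \<epsilon> * (E t - f p))) \<ge> (8 / c) * (exp (\<epsilon> * t) * (c / 8 * (norm (v t))\<^sup>2))"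
      using c_pos by (intro mult_left_mono) auto
    then have F': "F' t \<ge> exp (\<epsilon> * t) * (norm (v t))\<^sup>2 + exp (- (\<epsilon> * t))"
      using c_pos by (simp add: F'_def)
    \<comment> \<open>Splits \<open>norm (v t)\<close> into two factors whose squares are the two
      terms below \<open>F' t\<close>.\<close>
    define q where "q = exp (\<epsilon> * t / 2)"
    have q: "q > 0" "exp (\<epsilon> * t) = q\<^sup>2" "exp (- (\<epsilon> * t)) = (1 / q)\<^sup>2"
      by (auto simp: q_def exp_minus power_divide inverse_eq_divide simp flip: exp_double)
    have "norm (v t) = (q * norm (v t)) * (1 / q)" using q(1) by simp
    also have "\<dots> \<le> 2 * ((q * norm (v t)) * (1 / q))" using q(1) by simp
    also have "\<dots> \<le> (q * norm (v t))\<^sup>2 + (1 / q)\<^sup>2"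
      using sum_squares_bound[of "q * norm (v t)" "1 / q"] by (simp only: mult.assoc)
    also have "\<dots> \<le> F' t" using F' q by (simp add: power_mult_distrib)
    finally show "norm (v t) \<le> F' t" .
  qed
  moreover have "set_integrable lborel {0..T} v"
    by (rule borel_integrable_atLeastAtMost') (auto intro: continuous_on_subset[OF continuous_on_v])
  ultimately have "set_integrable lborel ({0..T} \<union> {T..}) v"
    by (intro set_integrable_Un) auto
  moreover have "{0..T} \<union> {T..} = {0..}" using T(1) by auto
  ultimately show ?thesis by simp
qed

end

section \<open>Saddle points\<close>

text \<open>Only the case of a vanishing quadratic form at \<open>v\<close> needs an idea: a small
  step from \<open>v\<close> against \<open>A *v v\<close>, nonzero by invertibility, lowers the
  form to first order.\<close>

lemma negative_direction_of_nondegenerate_symmetric: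
  fixes A :: "real^'n^'n"
  assumes sym: "\<And>a b. a \<bullet> (A *v b) = b \<bullet> (A *v a)" and inv: "invertible A"
    and npd: "v \<noteq> 0" "v \<bullet> (A *v v) \<le> 0"
  obtains a where "norm a = 1" "a \<bullet> (A *v a) < 0"
proof -
  obtain b where b: "b \<bullet> (A *v b) < 0"
  proof (cases "v \<bullet> (A *v v) = 0")
    case True
    define w where "w = A *v v"
    have w: "w \<noteq> 0"
      using inj_matrix_vector_mult[OF inv] npd(1) unfolding w_def
      by (metis injD matrix_vector_mult_0_right)
    \<comment> \<open>This step length keeps the second order term below half of the first order
      gain.\<close>
    let ?K = "norm A" and ?s = "1 / (norm A + 1)"
    have s: "?s > 0" by (simp add: add_nonneg_pos)
    have sK: "?s * ?K < 1" using norm_ge_zero[of A] by (simp add: divide_less_eq del: norm_ge_zero)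
    have "w \<bullet> (A *v w) \<le> norm w * norm (A *v w)" by (rule norm_cauchy_schwarz)
    also have "\<dots> \<le> norm w * (?K * norm w)"
      by (intro mult_left_mono norm_matrix_vector_mult_le) simp
    finally have ww: "w \<bullet> (A *v w) \<le> ?K * (norm w)\<^sup>2" by (simp add: power2_eq_square mult_ac)
    have "(v - ?s *\<^sub>R w) \<bullet> (A *v (v - ?s *\<^sub>R w))
        = v \<bullet> (A *v v) - 2 * ?s * (w \<bullet> (A *v v)) + ?s * (?s * (w \<bullet> (A *v w)))"
      using sym[of v w]
      by (simp add: matrix_vector_mult_diff_distrib matrix_vector_mult_scaleR inner_diff_left
          inner_diff_right algebra_simps)
    also have "\<dots> = ?s * (?s * (w \<bullet> (A *v w)) - 2 * (norm w)\<^sup>2)"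
      unfolding True unfolding w_def[symmetric] by (simp add: power2_norm_eq_inner right_diff_distrib)
    also have "\<dots> \<le> ?s * (?s * (?K * (norm w)\<^sup>2) - 2 * (norm w)\<^sup>2)"
      using s ww by (intro mult_left_mono diff_right_mono) auto
    also have "\<dots> = ?s * ((?s * ?K - 2) * (norm w)\<^sup>2)" by (simp add: algebra_simps)
    also have "\<dots> < 0"
    proof (rule mult_pos_neg[OF s mult_neg_pos])
      show "?s * ?K - 2 < 0" using sK by linarith
      show "0 < (norm w)\<^sup>2" using w by simp
    qed
    finally show ?thesis using that by blast
  next
    case False
    then show ?thesis using npd(2) that[of v] by simp
  qed
  have "b \<noteq> 0" using b by auto
  have "(b /\<^sub>R norm b) \<bullet> (A *v (b /\<^sub>R norm b)) = (b \<bullet> (A *v b)) / (norm b)\<^sup>2"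
    by (simp add: matrix_vector_mult_scaleR power2_eq_square divide_inverse)
  also have "\<dots> < 0" using b \<open>b \<noteq> 0\<close> by (simp add: divide_neg_pos)
  finally show thesis using that[of "b /\<^sub>R norm b"] \<open>b \<noteq> 0\<close> by simp
qed

text \<open>The form is negative on the line through \<open>(a, 0)\<close>, so the cone where it is
  nonnegative meets that line only in 0. Hence the component along \<open>a\<close> of a vector in
  the cone is bounded by the remaining components.\<close>

lemma energy_cone_transversal:
  fixes A :: "real^'n^'n"
  assumes sym: "\<And>a b. a \<bullet> (A *v b) = b \<bullet> (A *v a)"
    and a: "norm a = 1" "a \<bullet> (A *v a) < 0" and "\<beta> \<ge> 0"
  obtains C where "C \<ge> 0"
    "\<And>\<xi> \<eta>. (\<xi> + \<beta> *\<^sub>R \<eta>) \<bullet> (A *v (\<xi> + \<beta> *\<^sub>R \<eta>)) + (norm \<eta>)\<^sup>2 \<ge> 0 \<Longrightarrow>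
       norm (\<xi>, \<eta>) \<le> C * norm (\<xi> - (a \<bullet> \<xi>) *\<^sub>R a, \<eta>)"
proof -
  define \<mu> where "\<mu> = - (a \<bullet> (A *v a))"
  have \<mu>: "\<mu> > 0" using a by (simp add: \<mu>_def)
  let ?K = "norm A"
  \<comment> \<open>The sum of the coefficients in the quadratic inequality for \<open>s\<close>,
    which become comparable once \<open>\<bar>s\<bar> > r\<close>.\<close>
  define B where "B = 2 * ?K * (1 + \<beta>) + ?K * (1 + \<beta>)\<^sup>2 + 1"
  have B: "B \<ge> 0" using \<open>\<beta> \<ge> 0\<close> by (simp add: B_def)
  show thesis
  proof (rule that[of "B / \<mu> + 2"])
    show "0 \<le> B / \<mu> + 2" using B \<mu> by (simp add: add_nonneg_nonneg)
    fix \<xi> \<eta> :: "real^'n"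
    assume cone: "(\<xi> + \<beta> *\<^sub>R \<eta>) \<bullet> (A *v (\<xi> + \<beta> *\<^sub>R \<eta>)) + (norm \<eta>)\<^sup>2 \<ge> 0"
    define s where "s = a \<bullet> \<xi>"
    define p where "p = \<xi> - s *\<^sub>R a"
    define q where "q = p + \<beta> *\<^sub>R \<eta>"
    define r where "r = norm (p, \<eta>)"
    have r0: "r \<ge> 0" by (simp add: r_def)
    have pr: "norm p \<le> r" and er: "norm \<eta> \<le> r"
      unfolding r_def by (rule norm_fst_le norm_snd_le)+
    have "norm q \<le> norm p + norm (\<beta> *\<^sub>R \<eta>)" unfolding q_def by (rule norm_triangle_ineq)
    also have "\<dots> \<le> r + \<beta> * r" using pr er \<open>\<beta> \<ge> 0\<close> by (intro add_mono) (auto intro: mult_left_mono)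
    finally have qr: "norm q \<le> (1 + \<beta>) * r" by (simp add: algebra_simps)
    have w: "\<xi> + \<beta> *\<^sub>R \<eta> = s *\<^sub>R a + q" by (simp add: q_def p_def)
    have "(\<xi> + \<beta> *\<^sub>R \<eta>) \<bullet> (A *v (\<xi> + \<beta> *\<^sub>R \<eta>)) = - \<mu> * s\<^sup>2 + 2 * s * (a \<bullet> (A *v q)) + q \<bullet> (A *v q)"
      unfolding w using sym[of q a]
      by (simp add: matrix_vector_right_distrib matrix_vector_mult_scaleR inner_add_left
          inner_add_right \<mu>_def power2_eq_square algebra_simps)
    then have 1: "\<mu> * s\<^sup>2 \<le> 2 * s * (a \<bullet> (A *v q)) + q \<bullet> (A *v q) + (norm \<eta>)\<^sup>2"
      using cone by simp
    have Aq: "norm (A *v q) \<le> ?K * ((1 + \<beta>) * r)"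
      using norm_matrix_vector_mult_le[of A q] qr by (meson mult_left_mono norm_ge_zero order_trans)
    have "\<bar>a \<bullet> (A *v q)\<bar> \<le> ?K * ((1 + \<beta>) * r)"
      using Cauchy_Schwarz_ineq2[of a "A *v q"] Aq a(1) by simp
    then have "\<bar>2 * s * (a \<bullet> (A *v q))\<bar> \<le> 2 * \<bar>s\<bar> * (?K * ((1 + \<beta>) * r))"
      unfolding abs_mult by (intro mult_mono) auto
    moreover have "q \<bullet> (A *v q) \<le> ((1 + \<beta>) * r) * (?K * ((1 + \<beta>) * r))"
      using norm_cauchy_schwarz[of q "A *v q"] mult_mono[OF qr Aq] r0 \<open>\<beta> \<ge> 0\<close> by simp
    moreover have "(norm \<eta>)\<^sup>2 \<le> r\<^sup>2" using er by (intro power_mono) auto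
    ultimately have 2: "\<mu> * s\<^sup>2 \<le> 2 * \<bar>s\<bar> * (?K * ((1 + \<beta>) * r)) + (?K * (1 + \<beta>)\<^sup>2 + 1) * r\<^sup>2"
      using 1 by (simp add: power2_eq_square algebra_simps)
    \<comment> \<open>If \<open>\<bar>s\<bar> > r\<close>, then
      \<open>r\<^sup>2 \<le> \<bar>s\<bar> * r\<close> and one factor \<open>\<bar>s\<bar>\<close>
      can be divided out; otherwise the bound is immediate.\<close>
    have s: "\<bar>s\<bar> \<le> (B / \<mu> + 1) * r"
    proof (cases "\<bar>s\<bar> \<le> r")
      case True
      moreover have "(B / \<mu>) * r \<ge> 0" using B \<mu> r0 by simp
      ultimately show ?thesis by (simp add: algebra_simps)
    next
      case False
      then have "r\<^sup>2 \<le> \<bar>s\<bar> * r" using r0 by (simp add: power2_eq_square mult_right_mono)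
      then have "(?K * (1 + \<beta>)\<^sup>2 + 1) * r\<^sup>2 \<le> (?K * (1 + \<beta>)\<^sup>2 + 1) * (\<bar>s\<bar> * r)"
        by (intro mult_left_mono) auto
      with 2 have "\<mu> * s\<^sup>2 \<le> B * (\<bar>s\<bar> * r)" by (simp add: B_def algebra_simps)
      moreover have "s\<^sup>2 = \<bar>s\<bar> * \<bar>s\<bar>" by (simp add: power2_eq_square)
      ultimately have "\<bar>s\<bar> * (\<mu> * \<bar>s\<bar>) \<le> \<bar>s\<bar> * (B * r)" by (simp only: mult_ac)
      then have "\<mu> * \<bar>s\<bar> \<le> B * r" using False r0 by (simp add: mult_le_cancel_left)
      then have "\<bar>s\<bar> \<le> B / \<mu> * r" using \<mu> by (simp add: field_simps)
      then show ?thesis using r0 by (simp add: algebra_simps)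
    qed
    have "norm (\<xi>, \<eta>) = norm ((s *\<^sub>R a, 0) + (p, \<eta>))" by (simp add: p_def)
    also have "\<dots> \<le> norm (s *\<^sub>R a, 0 :: real^'n) + r" unfolding r_def by (rule norm_triangle_ineq)
    also have "\<dots> = \<bar>s\<bar> + r" using a(1) by (simp add: norm_Pair)
    also have "\<dots> \<le> (B / \<mu> + 2) * r" using s by (simp add: algebra_simps)
    finally show "norm (\<xi>, \<eta>) \<le> (B / \<mu> + 2) * norm (\<xi> - (a \<bullet> \<xi>) *\<^sub>R a, \<eta>)"
      by (simp add: r_def p_def s_def)
  qed
qed

section \<open>Comparison of two solutions\<close>

context inertial_morse
begin

lemma solution_difference_derivatives:
  assumes "is_solution g c \<beta> x0 v0 x v" "is_solution g c \<beta> x0' v0' x' v'" "t \<ge> 0"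
  shows "((\<lambda>t. x t - x' t) has_derivative (\<lambda>h. h *\<^sub>R (v t - v' t))) (at t within {0..})"
    and "((\<lambda>t. v t - v' t) has_derivative
      (\<lambda>h. h *\<^sub>R - (c *\<^sub>R (v t - v' t) + (g (x t + \<beta> *\<^sub>R v t) - g (x' t + \<beta> *\<^sub>R v' t))))) (at t within {0..})"
  using has_vector_derivative_diff[OF solution_derivatives(1)[OF assms(1,3)] solution_derivatives(1)[OF assms(2,3)]]
    has_vector_derivative_diff[OF solution_derivatives(2)[OF assms(1,3)] solution_derivatives(2)[OF assms(2,3)]]
  by (auto simp: has_vector_derivative_def algebra_simps)

text \<open>Gronwall's inequality backwards in time: the squared distance \<open>Q\<close> of the
  two states satisfies \<open>Q' \<ge> - \<Lambda> * Q\<close>, so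
  \<open>exp (\<Lambda> * t) * Q t\<close> is nondecreasing. The bound \<open>R\<close> makes the
  Lipschitz constant of \<open>g\<close> the same for all pairs of solutions.\<close>

lemma backward_Lipschitz:
  assumes "T \<ge> 0"
  obtains C where "C \<ge> 0"
    "\<And>x0 v0 x v x0' v0' x' v'. is_solution g c \<beta> x0 v0 x v \<Longrightarrow> is_solution g c \<beta> x0' v0' x' v' \<Longrightarrow>
      (\<And>t. t \<ge> 0 \<Longrightarrow> norm (x t + \<beta> *\<^sub>R v t) \<le> R) \<Longrightarrow> (\<And>t. t \<ge> 0 \<Longrightarrow> norm (x' t + \<beta> *\<^sub>R v' t) \<le> R) \<Longrightarrow>
      norm ((x0, v0) - (x0', v0')) \<le> C * norm (x T - x' T, v T - v' T)"
proof -
  obtain L where L: "L \<ge> 0" "\<And>y z. norm y \<le> R \<Longrightarrow> norm z \<le> R \<Longrightarrow> norm (g y - g z) \<le> L * norm (y - z)"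
    using C2_grad_Lipschitz_on_cball[OF C2] by blast
  \<comment> \<open>The 1 absorbs the product of position and velocity differences,
    \<open>2 * c\<close> the damping, and the terms with \<open>L\<close> the difference of
    gradients.\<close>
  define \<Lambda> where "\<Lambda> = 1 + 2 * c + L + 2 * L * \<beta>"
  show thesis
  proof (rule that[of "sqrt (exp (\<Lambda> * T))"])
    fix x0 v0 x v x0' v0' x' v'
    assume s1: "is_solution g c \<beta> x0 v0 x v" and s2: "is_solution g c \<beta> x0' v0' x' v'"
      and R: "\<And>t. t \<ge> 0 \<Longrightarrow> norm (x t + \<beta> *\<^sub>R v t) \<le> R" "\<And>t. t \<ge> 0 \<Longrightarrow> norm (x' t + \<beta> *\<^sub>R v' t) \<le> R"
    define \<xi> where "\<xi> t = x t - x' t" for t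
    define \<eta> where "\<eta> t = v t - v' t" for t
    define \<gamma> where "\<gamma> t = g (x t + \<beta> *\<^sub>R v t) - g (x' t + \<beta> *\<^sub>R v' t)" for t
    note d = solution_difference_derivatives[OF s1 s2, folded \<xi>_def \<eta>_def \<gamma>_def]
    define Q where "Q t = \<xi> t \<bullet> \<xi> t + \<eta> t \<bullet> \<eta> t" for t
    define Q' where "Q' t = 2 * (\<xi> t \<bullet> \<eta> t) - 2 * c * (\<eta> t \<bullet> \<eta> t) - 2 * (\<eta> t \<bullet> \<gamma> t)" for t
    have dQ: "(Q has_real_derivative Q' t) (at t within {0..})" if "t \<ge> 0" for t
    proof -
      have "(Q has_derivative (\<lambda>h. (\<xi> t \<bullet> (h *\<^sub>R \<eta> t) + (h *\<^sub>R \<eta> t) \<bullet> \<xi> t) +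
         (\<eta> t \<bullet> (h *\<^sub>R - (c *\<^sub>R \<eta> t + \<gamma> t)) + (h *\<^sub>R - (c *\<^sub>R \<eta> t + \<gamma> t)) \<bullet> \<eta> t))) (at t within {0..})"
        unfolding Q_def[abs_def] by (intro has_derivative_add has_derivative_inner d that)
      then show ?thesis
        unfolding has_field_derivative_def
        by (rule has_derivative_eq_rhs)
          (auto simp: fun_eq_iff Q'_def inner_add_right inner_add_left inner_commute algebra_simps)
    qed
    have ge: "Q' t + \<Lambda> * Q t \<ge> 0" if "t \<ge> 0" for t
    proof -
      let ?a = "norm (\<xi> t)" and ?b = "norm (\<eta> t)"
      have Q: "Q t = ?a\<^sup>2 + ?b\<^sup>2" by (simp add: Q_def power2_norm_eq_inner)
      have ab: "2 * (?a * ?b) \<le> ?a\<^sup>2 + ?b\<^sup>2" using sum_squares_bound[of ?a ?b] by simp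
      have "norm (\<gamma> t) \<le> L * norm (\<xi> t + \<beta> *\<^sub>R \<eta> t)"
        using L(2)[OF R(1)[OF that] R(2)[OF that]] by (simp add: \<gamma>_def \<xi>_def \<eta>_def algebra_simps)
      also have "\<dots> \<le> L * (?a + \<beta> * ?b)"
        using norm_triangle_ineq[of "\<xi> t" "\<beta> *\<^sub>R \<eta> t"] L(1) beta by (intro mult_left_mono) auto
      finally have "?b * norm (\<gamma> t) \<le> ?b * (L * (?a + \<beta> * ?b))" by (intro mult_left_mono) auto
      moreover have "\<eta> t \<bullet> \<gamma> t \<le> ?b * norm (\<gamma> t)" by (rule norm_cauchy_schwarz)
      ultimately have 1: "2 * (\<eta> t \<bullet> \<gamma> t) \<le> L * (2 * (?a * ?b)) + 2 * L * \<beta> * ?b\<^sup>2"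
        by (simp add: power2_eq_square algebra_simps)
      have 2: "L * (2 * (?a * ?b)) \<le> L * (?a\<^sup>2 + ?b\<^sup>2)" using ab L(1) by (rule mult_left_mono)
      have 3: "2 * (\<xi> t \<bullet> \<eta> t) \<ge> - (?a\<^sup>2 + ?b\<^sup>2)"
        using Cauchy_Schwarz_ineq2[of "\<xi> t" "\<eta> t"] ab by linarith
      have 4: "(2 * c + 2 * L * \<beta>) * ?a\<^sup>2 \<ge> 0" using c_pos L(1) beta by simp
      have "Q' t + \<Lambda> * Q t = 2 * (\<xi> t \<bullet> \<eta> t) + (?a\<^sup>2 + ?b\<^sup>2) - 2 * (\<eta> t \<bullet> \<gamma> t)
          + L * (?a\<^sup>2 + ?b\<^sup>2) + 2 * L * \<beta> * ?b\<^sup>2 + (2 * c + 2 * L * \<beta>) * ?a\<^sup>2"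
        unfolding Q Q'_def \<Lambda>_def by (simp add: power2_norm_eq_inner algebra_simps)
      then show ?thesis using 1 2 3 4 by linarith
    qed
    have "exp (\<Lambda> * 0) * Q 0 \<le> exp (\<Lambda> * T) * Q T"
    proof (rule has_real_derivative_nonneg_mono_atLeast[of 0 "\<lambda>t. exp (\<Lambda> * t) * Q t" "\<lambda>t. exp (\<Lambda> * t) * (Q' t + \<Lambda> * Q t)"])
      show "((\<lambda>t. exp (\<Lambda> * t) * Q t) has_real_derivative exp (\<Lambda> * t) * (Q' t + \<Lambda> * Q t)) (at t within {0..})"
        if "t \<ge> 0" for t
        using that by (auto intro!: derivative_eq_intros dQ simp: algebra_simps)
    qed (use ge \<open>T \<ge> 0\<close> in auto)
    then have "sqrt (Q 0) \<le> sqrt (exp (\<Lambda> * T)) * sqrt (Q T)"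
      by (simp flip: real_sqrt_mult)
    moreover have "norm (\<xi> t, \<eta> t) = sqrt (Q t)" for t
      by (simp add: norm_Pair Q_def power2_norm_eq_inner)
    moreover have "\<xi> 0 = x0 - x0'" "\<eta> 0 = v0 - v0'"
      using s1 s2 by (auto simp: is_solution_def \<xi>_def \<eta>_def)
    ultimately show "norm ((x0, v0) - (x0', v0')) \<le> sqrt (exp (\<Lambda> * T)) * norm (x T - x' T, v T - v' T)"
      by (metis \<xi>_def \<eta>_def diff_Pair)
  qed simp
qed

text \<open>The negative of the linearised energy of the difference of two solutions, as long as it is
  positive, grows exponentially near \<open>p\<close>.\<close>

lemma difference_energy_nonneg_near_critical_point:
  assumes "critical_point g p"
  obtains r where "r > 0"
    "\<And>x0 v0 x v x0' v0' x' v' T. is_solution g c \<beta> x0 v0 x v \<Longrightarrow> is_solution g c \<beta> x0' v0' x' v' \<Longrightarrow> T \<ge> 0 \<Longrightarrow>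
      (\<And>t. t \<ge> T \<Longrightarrow> x t + \<beta> *\<^sub>R v t \<in> ball p r) \<Longrightarrow> (\<And>t. t \<ge> T \<Longrightarrow> x' t + \<beta> *\<^sub>R v' t \<in> ball p r) \<Longrightarrow>
      ((x T - x' T) + \<beta> *\<^sub>R (v T - v' T)) \<bullet> (H p *v ((x T - x' T) + \<beta> *\<^sub>R (v T - v' T)))
        + (norm (v T - v' T))\<^sup>2 \<ge> 0"
proof -
  let ?A = "H p"
  have sym: "a \<bullet> (?A *v b) = b \<bullet> (?A *v a)" for a b by (rule C2_grad_hess_symmetric[OF C2])
  obtain m where m: "m > 0" "\<And>v. m * norm v \<le> norm (?A *v v)"
    using Morse assms invertible_matrix_bounded_below by (metis morse_def)
  \<comment> \<open>Chosen so that the nonlinear remainder costs an eighth of the diagonal form,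
    half of what \<open>dissipation_ge\<close> provides.\<close>
  define \<epsilon> where "\<epsilon> = m * min \<beta> c / (8 * (\<beta> + 1))"
  have \<epsilon>: "\<epsilon> > 0" using m beta c_pos by (simp add: \<epsilon>_def)
  obtain r where r: "r > 0"
    "\<And>y z. y \<in> ball p r \<Longrightarrow> z \<in> ball p r \<Longrightarrow> norm (g y - g z - ?A *v (y - z)) \<le> \<epsilon> * norm (y - z)"
    using C2_grad_Lipschitz_near[OF C2 \<epsilon>] by blast
  show thesis
  proof (rule that[OF r(1)])
    fix x0 v0 x v x0' v0' x' v' T
    assume s1: "is_solution g c \<beta> x0 v0 x v" and s2: "is_solution g c \<beta> x0' v0' x' v'" and T: "(T::real) \<ge> 0"
      and near: "\<And>t. t \<ge> T \<Longrightarrow> x t + \<beta> *\<^sub>R v t \<in> ball p r" "\<And>t. t \<ge> T \<Longrightarrow> x' t + \<beta> *\<^sub>R v' t \<in> ball p r"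
    define \<xi> where "\<xi> t = x t - x' t" for t
    define \<eta> where "\<eta> t = v t - v' t" for t
    define \<gamma> where "\<gamma> t = g (x t + \<beta> *\<^sub>R v t) - g (x' t + \<beta> *\<^sub>R v' t)" for t
    define w where "w t = \<xi> t + \<beta> *\<^sub>R \<eta> t" for t
    have w_eq: "w t = (x t + \<beta> *\<^sub>R v t) - (x' t + \<beta> *\<^sub>R v' t)" for t
      by (simp add: w_def \<xi>_def \<eta>_def algebra_simps)
    define V where "V t = - (w t \<bullet> (?A *v w t) + \<eta> t \<bullet> \<eta> t) / 2" for t
    define V' where "V' t = - ((\<eta> t - \<beta> *\<^sub>R (c *\<^sub>R \<eta> t + \<gamma> t)) \<bullet> (?A *v w t)) + \<eta> t \<bullet> (c *\<^sub>R \<eta> t + \<gamma> t)" for t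
    have dV: "(V has_real_derivative V' t) (at t within {T..})" if t: "t \<ge> T" for t
    proof -
      have t0: "t \<ge> 0" using t T by simp
      note d = solution_difference_derivatives[OF s1 s2 t0, folded \<xi>_def \<eta>_def \<gamma>_def]
      let ?e = "\<lambda>h. h *\<^sub>R - (c *\<^sub>R \<eta> t + \<gamma> t)"
      let ?w = "\<lambda>h. h *\<^sub>R \<eta> t + \<beta> *\<^sub>R ?e h"
      have dw: "(w has_derivative ?w) (at t within {0..})"
        unfolding w_def[abs_def] by (intro has_derivative_add has_derivative_scaleR_right d)
      have "(V has_derivative (\<lambda>h. - ((w t \<bullet> (?A *v ?w h) + ?w h \<bullet> (?A *v w t)) +
          (\<eta> t \<bullet> ?e h + ?e h \<bullet> \<eta> t)) / 2)) (at t within {0..})"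
        unfolding V_def[abs_def]
        by (intro bounded_linear.has_derivative[OF bounded_linear_divide] has_derivative_minus
            has_derivative_add has_derivative_inner
            bounded_linear.has_derivative[OF matrix_vector_mul_bounded_linear] dw d)
      moreover have "- ((w t \<bullet> (?A *v ?w h) + ?w h \<bullet> (?A *v w t)) + (\<eta> t \<bullet> ?e h + ?e h \<bullet> \<eta> t)) / 2 = V' t * h" for h
      proof -
        have wh: "?w h = h *\<^sub>R (\<eta> t - \<beta> *\<^sub>R (c *\<^sub>R \<eta> t + \<gamma> t))" by (simp add: algebra_simps)
        \<comment> \<open>Symmetry of \<open>?A\<close> merges the two halves of the derivative of
          the quadratic form.\<close>
        have "- ((w t \<bullet> (?A *v ?w h) + ?w h \<bullet> (?A *v w t)) + (\<eta> t \<bullet> ?e h + ?e h \<bullet> \<eta> t)) / 2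
           = - (?w h \<bullet> (?A *v w t)) - \<eta> t \<bullet> ?e h"
          using sym[of "w t" "?w h"] inner_commute[of "?e h" "\<eta> t"] by (simp only:) simp
        also have "\<dots> = V' t * h"
          unfolding wh V'_def inner_scaleR_left inner_scaleR_right inner_minus_right by (simp add: algebra_simps)
        finally show ?thesis .
      qed
      ultimately have "(V has_derivative (\<lambda>h. V' t * h)) (at t within {0..})" by simp
      then show ?thesis
        unfolding has_field_derivative_def using T by (auto intro: has_derivative_subset)
    qed
    \<comment> \<open>Fits \<open>2 * V t \<le> (norm (?A *v w t))\<^sup>2 / m\<close>: then
      \<open>\<kappa> * V t\<close> stays below the gradient part of the lower bound for
      \<open>V' t\<close>.\<close>
    define \<kappa> where "\<kappa> = \<beta> * m / 4"
    have \<kappa>: "\<kappa> > 0" using beta m by (simp add: \<kappa>_def)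
    have grow: "V' t - \<kappa> * V t \<ge> 0" if t: "t \<ge> T" for t
    proof -
      define \<rho> where "\<rho> = \<gamma> t - ?A *v w t"
      let ?h = "norm (?A *v w t)" and ?q = "norm (\<eta> t)"
      have w: "norm (w t) \<le> ?h / m" using m(2)[of "w t"] m(1) by (simp add: field_simps)
      have "norm \<rho> \<le> \<epsilon> * norm (w t)"
        using r(2)[OF near(1)[OF t] near(2)[OF t]] unfolding \<rho>_def \<gamma>_def w_eq .
      also have "\<dots> \<le> \<epsilon> * (?h / m)" using w \<epsilon> by (intro mult_left_mono) auto
      also have "\<dots> = min \<beta> c / (8 * (\<beta> + 1)) * ?h" using m(1) by (simp add: \<epsilon>_def)
      finally have \<rho>: "norm \<rho> \<le> min \<beta> c / (8 * (\<beta> + 1)) * ?h" .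
      \<comment> \<open>Writing \<open>\<gamma> t\<close> as \<open>?A *v w t + \<rho>\<close>
        leaves the form of \<open>dissipation_ge\<close> at \<open>?A *v w t\<close> and
        \<open>\<eta> t\<close>, plus an error linear in \<open>\<rho>\<close>.\<close>
      have "V' t = (\<beta> * ?h\<^sup>2 + \<beta> * c * (\<eta> t \<bullet> (?A *v w t)) + c * ?q\<^sup>2) + (\<beta> *\<^sub>R (?A *v w t) + \<eta> t) \<bullet> \<rho>"
        unfolding V'_def \<rho>_def power2_norm_eq_inner
        by (simp add: inner_add_left inner_add_right inner_diff_left inner_diff_right inner_commute algebra_simps)
      moreover have "\<bar>(\<beta> *\<^sub>R (?A *v w t) + \<eta> t) \<bullet> \<rho>\<bar> \<le> (\<beta> * ?h\<^sup>2 + c * ?q\<^sup>2) / 8"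
      proof -
        have n: "norm (\<beta> *\<^sub>R (?A *v w t) + \<eta> t) \<le> \<beta> * ?h + ?q"
          using norm_triangle_ineq[of "\<beta> *\<^sub>R (?A *v w t)" "\<eta> t"] beta by simp
        have qh: "?q * ?h \<le> ?h\<^sup>2 + ?q\<^sup>2"
        proof -
          have "2 * (?q * ?h) \<le> ?h\<^sup>2 + ?q\<^sup>2" using sum_squares_bound[of ?q ?h] by simp
          moreover have "?q * ?h \<ge> 0" by simp
          ultimately show ?thesis by linarith
        qed
        have e: "(\<beta> * ?h + ?q) * ?h \<le> (\<beta> + 1) * (?h\<^sup>2 + ?q\<^sup>2)"
        proof -
          have "\<beta> * ?q\<^sup>2 \<ge> 0" using beta by simp
          then show ?thesis using qh by (simp add: power2_eq_square algebra_simps)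
        qed
        have "\<bar>(\<beta> *\<^sub>R (?A *v w t) + \<eta> t) \<bullet> \<rho>\<bar> \<le> (\<beta> * ?h + ?q) * (min \<beta> c / (8 * (\<beta> + 1)) * ?h)"
          using Cauchy_Schwarz_ineq2[of "\<beta> *\<^sub>R (?A *v w t) + \<eta> t" \<rho>] mult_mono[OF n \<rho>] beta
          by (meson add_nonneg_nonneg mult_nonneg_nonneg norm_ge_zero order_trans less_imp_le)
        also have "\<dots> = min \<beta> c / (8 * (\<beta> + 1)) * ((\<beta> * ?h + ?q) * ?h)" by simp
        also have "\<dots> \<le> min \<beta> c / (8 * (\<beta> + 1)) * ((\<beta> + 1) * (?h\<^sup>2 + ?q\<^sup>2))"
          using e beta c_pos by (intro mult_left_mono) auto
        also have "\<dots> = (min \<beta> c * ?h\<^sup>2 + min \<beta> c * ?q\<^sup>2) / 8" using beta by (simp add: field_simps)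
        also have "\<dots> \<le> (\<beta> * ?h\<^sup>2 + c * ?q\<^sup>2) / 8"
          by (intro divide_right_mono add_mono mult_right_mono) auto
        finally show ?thesis .
      qed
      ultimately have V': "V' t \<ge> \<beta> * ?h\<^sup>2 / 8 + c * ?q\<^sup>2 / 8"
        using dissipation_ge[of "?A *v w t" "\<eta> t"] by (simp add: add_divide_distrib)
      have "- (w t \<bullet> (?A *v w t)) \<le> norm (w t) * ?h"
        using Cauchy_Schwarz_ineq2[of "w t" "?A *v w t"] by linarith
      moreover have "norm (w t) * ?h \<le> ?h / m * ?h" using w by (intro mult_right_mono) auto
      moreover have "2 * V t = - (w t \<bullet> (?A *v w t)) - \<eta> t \<bullet> \<eta> t" by (simp add: V_def)
      ultimately have "2 * V t \<le> ?h / m * ?h" using inner_ge_zero[of "\<eta> t"] by linarith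
      then have "\<kappa> * (2 * V t) \<le> \<kappa> * (?h / m * ?h)" using \<kappa> by (intro mult_left_mono) auto
      also have "\<dots> = \<beta> * ?h\<^sup>2 / 4" using m(1) by (simp add: \<kappa>_def power2_eq_square)
      finally have "\<kappa> * V t \<le> \<beta> * ?h\<^sup>2 / 8" by simp
      moreover have "c * ?q\<^sup>2 / 8 \<ge> 0" using c_pos by simp
      ultimately show ?thesis using V' by linarith
    qed
    have mono: "exp (- \<kappa> * T) * V T \<le> exp (- \<kappa> * t) * V t" if "t \<ge> T" for t
    proof (rule has_real_derivative_nonneg_mono_atLeast[of T "\<lambda>t. exp (- \<kappa> * t) * V t" "\<lambda>t. exp (- \<kappa> * t) * (V' t - \<kappa> * V t)"])
      show "((\<lambda>t. exp (- \<kappa> * t) * V t) has_real_derivative exp (- \<kappa> * t) * (V' t - \<kappa> * V t)) (at t within {T..})"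
        if "t \<ge> T" for t
        using that by (auto intro!: derivative_eq_intros dV simp: algebra_simps)
    qed (use grow that in auto)
    \<comment> \<open>Both extrapolated points stay in \<open>ball p r\<close>, so \<open>w\<close>
      is bounded, and the velocity difference only lowers \<open>V\<close>.\<close>
    have bd: "V t \<le> 2 * r * (norm ?A * (2 * r))" if t: "t \<ge> T" for t
    proof -
      have "norm (w t) \<le> norm ((x t + \<beta> *\<^sub>R v t) - p) + norm ((x' t + \<beta> *\<^sub>R v' t) - p)"
        unfolding w_eq using norm_triangle_ineq4[of "(x t + \<beta> *\<^sub>R v t) - p" "(x' t + \<beta> *\<^sub>R v' t) - p"]
        by (simp only: diff_diff_eq2 diff_add_cancel)
      also have "\<dots> \<le> 2 * r"
        using near(1)[OF t] near(2)[OF t] by (simp add: dist_norm norm_minus_commute)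
      finally have w: "norm (w t) \<le> 2 * r" .
      have "norm (?A *v w t) \<le> norm ?A * (2 * r)"
        using norm_matrix_vector_mult_le[of ?A "w t"] w by (meson mult_left_mono norm_ge_zero order_trans)
      then have "norm (w t) * norm (?A *v w t) \<le> 2 * r * (norm ?A * (2 * r))"
        using w r(1) by (intro mult_mono) auto
      moreover have "- (w t \<bullet> (?A *v w t)) \<le> norm (w t) * norm (?A *v w t)"
        using Cauchy_Schwarz_ineq2[of "w t" "?A *v w t"] by linarith
      moreover have "norm (w t) * norm (?A *v w t) \<ge> 0" "\<eta> t \<bullet> \<eta> t \<ge> 0" by auto
      moreover have "2 * V t = - (w t \<bullet> (?A *v w t)) - \<eta> t \<bullet> \<eta> t" by (simp add: V_def)
      ultimately show ?thesis by linarith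
    qed
    define B where "B = 2 * r * (norm ?A * (2 * r))"
    have "V T \<le> 0"
    proof (rule ccontr)
      assume "\<not> V T \<le> 0"
      then have VT: "V T > 0" by simp
      \<comment> \<open>So late that even \<open>1 + \<kappa> * (t - T)\<close>, a lower bound for
        the growth factor, pushes \<open>V\<close> beyond \<open>B\<close>.\<close>
      define t where "t = T + max 0 (B / (\<kappa> * V T))"
      have t: "t \<ge> T" by (simp add: t_def)
      have "\<kappa> * (t - T) * V T \<ge> \<kappa> * (B / (\<kappa> * V T)) * V T"
        using VT \<kappa> by (intro mult_right_mono mult_left_mono) (auto simp: t_def)
      then have b: "\<kappa> * (t - T) * V T \<ge> B" using VT \<kappa> by simp
      have "(1 + \<kappa> * (t - T)) * V T \<le> exp (\<kappa> * (t - T)) * V T"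
        using VT by (intro mult_right_mono exp_ge_add_one_self) auto
      also have "\<dots> = exp (\<kappa> * t) * (exp (- \<kappa> * T) * V T)"
        by (simp add: right_diff_distrib exp_diff exp_minus field_simps)
      also have "\<dots> \<le> exp (\<kappa> * t) * (exp (- \<kappa> * t) * V t)" using mono[OF t] by (intro mult_left_mono) auto
      also have "\<dots> = V t" by (simp add: exp_minus)
      also have "\<dots> \<le> B" using bd[OF t] by (simp add: B_def)
      finally show False using b VT by (simp add: algebra_simps)
    qed
    then show "((x T - x' T) + \<beta> *\<^sub>R (v T - v' T)) \<bullet> (?A *v ((x T - x' T) + \<beta> *\<^sub>R (v T - v' T)))
        + (norm (v T - v' T))\<^sup>2 \<ge> 0"
      by (simp add: V_def w_def \<xi>_def \<eta>_def power2_norm_eq_inner)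
  qed
qed

text \<open>Differences of trapped states at time \<open>T\<close> lie in the energy cone, hence are
  controlled by their projection along \<open>a\<close>, and \<open>backward_Lipschitz\<close>
  carries this to time 0. The radius depends on \<open>p\<close> alone, so that \<open>T\<close> and
  \<open>R\<close> can later run through countable sets.\<close>

lemma negligible_trapped_near_saddle:
  assumes crit: "critical_point g p" and nmin: "\<not> local_min_pt g H p"
  obtains r where "r > 0"
    "\<And>T R. T \<ge> 0 \<Longrightarrow> negligible {z. \<exists>x v. is_solution g c \<beta> (fst z) (snd z) x v \<and>
        (\<forall>t\<ge>0. norm (x t + \<beta> *\<^sub>R v t) \<le> R) \<and> (\<forall>t\<ge>T. x t + \<beta> *\<^sub>R v t \<in> ball p r)}"
proof -
  have sym: "a \<bullet> (H p *v b) = b \<bullet> (H p *v a)" for a b by (rule C2_grad_hess_symmetric[OF C2])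
  have inv: "invertible (H p)" using Morse crit by (simp add: morse_def)
  obtain u where u: "u \<noteq> 0" "u \<bullet> (H p *v u) \<le> 0"
    using crit nmin by (auto simp: local_min_pt_def not_less)
  obtain a where a: "norm a = 1" "a \<bullet> (H p *v a) < 0"
    by (rule negative_direction_of_nondegenerate_symmetric[OF sym inv u])
  obtain C1 where C1: "C1 \<ge> 0"
    "\<And>\<xi> \<eta>. (\<xi> + \<beta> *\<^sub>R \<eta>) \<bullet> (H p *v (\<xi> + \<beta> *\<^sub>R \<eta>)) + (norm \<eta>)\<^sup>2 \<ge> 0 \<Longrightarrow>
       norm (\<xi>, \<eta>) \<le> C1 * norm (\<xi> - (a \<bullet> \<xi>) *\<^sub>R a, \<eta>)"
    using energy_cone_transversal[OF sym a, of \<beta>] beta by (metis less_imp_le)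
  obtain r where r: "r > 0"
    "\<And>x0 v0 x v x0' v0' x' v' T. is_solution g c \<beta> x0 v0 x v \<Longrightarrow> is_solution g c \<beta> x0' v0' x' v' \<Longrightarrow> T \<ge> 0 \<Longrightarrow>
      (\<And>t. t \<ge> T \<Longrightarrow> x t + \<beta> *\<^sub>R v t \<in> ball p r) \<Longrightarrow> (\<And>t. t \<ge> T \<Longrightarrow> x' t + \<beta> *\<^sub>R v' t \<in> ball p r) \<Longrightarrow>
      ((x T - x' T) + \<beta> *\<^sub>R (v T - v' T)) \<bullet> (H p *v ((x T - x' T) + \<beta> *\<^sub>R (v T - v' T)))
        + (norm (v T - v' T))\<^sup>2 \<ge> 0"
    by (rule difference_energy_nonneg_near_critical_point[OF crit]) blast
  show thesis
  proof (rule that[OF r(1)])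
    fix T R :: real assume "T \<ge> 0"
    let ?P = "\<lambda>z x v. is_solution g c \<beta> (fst z) (snd z) x v \<and>
        (\<forall>t\<ge>0. norm (x t + \<beta> *\<^sub>R v t) \<le> R) \<and> (\<forall>t\<ge>T. x t + \<beta> *\<^sub>R v t \<in> ball p r)"
    let ?N = "{z. \<exists>x v. ?P z x v}"
    \<comment> \<open>One trapped solution is fixed per initial condition, making the state at time
      \<open>T\<close> a function of \<open>z\<close>.\<close>
    have "\<forall>z\<in>?N. \<exists>s. ?P z (fst s) (snd s)" by simp
    from bchoice[OF this] obtain S where "\<forall>z\<in>?N. ?P z (fst (S z)) (snd (S z))" ..
    then have S: "?P z (fst (S z)) (snd (S z))" if "z \<in> ?N" for z using that by blast
    obtain C2 where C2: "C2 \<ge> 0"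
      "\<And>x0 v0 x v x0' v0' x' v'. is_solution g c \<beta> x0 v0 x v \<Longrightarrow> is_solution g c \<beta> x0' v0' x' v' \<Longrightarrow>
      (\<And>t. t \<ge> 0 \<Longrightarrow> norm (x t + \<beta> *\<^sub>R v t) \<le> R) \<Longrightarrow> (\<And>t. t \<ge> 0 \<Longrightarrow> norm (x' t + \<beta> *\<^sub>R v' t) \<le> R) \<Longrightarrow>
      norm ((x0, v0) - (x0', v0')) \<le> C2 * norm (x T - x' T, v T - v' T)"
      by (rule backward_Lipschitz[OF \<open>T \<ge> 0\<close>]) blast
    \<comment> \<open>The state at time \<open>T\<close> with its component along
      \<open>(a, 0)\<close> removed; the cone bound \<open>C1\<close> and the backward bound
      \<open>C2\<close> multiply to the Lipschitz constant of its inverse.\<close>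
    define \<phi> where "\<phi> z = (fst (S z) T - (a \<bullet> fst (S z) T) *\<^sub>R a, snd (S z) T)" for z
    show "negligible ?N"
    proof (rule negligible_of_inverse_Lipschitz_into_hyperplane[of "(a, 0)" _ \<phi> "C2 * C1"])
      show "(a, 0) \<noteq> (0 :: (real^'n) \<times> (real^'n))" using a(1) by (auto simp: zero_prod_def)
      show "(a, 0) \<bullet> \<phi> z = 0" for z
        using a(1) by (simp add: \<phi>_def inner_diff_right flip: power2_norm_eq_inner)
      fix z w assume "z \<in> ?N" "w \<in> ?N"
      note Sz = S[OF this(1)] and Sw = S[OF this(2)]
      define \<xi> where "\<xi> = fst (S z) T - fst (S w) T"
      define \<eta> where "\<eta> = snd (S z) T - snd (S w) T"
      have "norm (z - w) \<le> C2 * norm (\<xi>, \<eta>)"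
        unfolding \<xi>_def \<eta>_def
        using C2(2)[of "fst z" "snd z" "fst (S z)" "snd (S z)" "fst w" "snd w" "fst (S w)" "snd (S w)"] Sz Sw
        by simp
      also have "norm (\<xi>, \<eta>) \<le> C1 * norm (\<xi> - (a \<bullet> \<xi>) *\<^sub>R a, \<eta>)"
        unfolding \<xi>_def \<eta>_def
        by (rule C1(2), rule r(2)[of "fst z" "snd z" _ _ "fst w" "snd w"]) (use Sz Sw \<open>T \<ge> 0\<close> in auto)
      also have "(\<xi> - (a \<bullet> \<xi>) *\<^sub>R a, \<eta>) = \<phi> z - \<phi> w"
        by (simp add: \<phi>_def \<xi>_def \<eta>_def inner_diff_right algebra_simps)
      finally show "norm (z - w) \<le> C2 * C1 * norm (\<phi> z - \<phi> w)"
        using C2(1) by (simp add: mult_left_mono mult.assoc)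
    qed
  qed
qed

section \<open>Almost every initial condition\<close>

lemma countable_critical_points: "countable {p. critical_point g p}"
proof -
  obtain I :: "nat set" and xk where "{p. critical_point g p} = (\<Union>k\<in>I. {xk k})"
    using Morse unfolding morse_def by blast
  then show ?thesis by simp
qed

text \<open>Every solution converges to some critical point. If that point is not a minimum, the
  solution is eventually trapped near it, which puts the initial condition into one of countably
  many null sets.\<close>

lemma AE_converges_to_local_min:
  assumes bdd: "\<And>x0 v0 x v. is_solution g c \<beta> x0 v0 x v \<Longrightarrow> bounded (x ` {0..})"
  shows "AE z in (lborel :: ((real^'n) \<times> (real^'n)) measure).
     \<forall>x v. is_solution g c \<beta> (fst z) (snd z) x v \<longrightarrow> (\<exists>p. local_min_pt g H p \<and> (x \<longlongrightarrow> p) at_top)"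
proof -
  define S where "S = {p. critical_point g p \<and> \<not> local_min_pt g H p}"
  have S: "countable S" unfolding S_def by (rule countable_subset[OF _ countable_critical_points]) auto
  let ?N = "\<lambda>p r (T::real) (R::real). {z. \<exists>x v. is_solution g c \<beta> (fst z) (snd z) x v \<and>
        (\<forall>t\<ge>0. norm (x t + \<beta> *\<^sub>R v t) \<le> R) \<and> (\<forall>t\<ge>T. x t + \<beta> *\<^sub>R v t \<in> ball p r)}"
  have "\<exists>r>0. \<forall>T\<ge>0. \<forall>R. negligible (?N p r T R)" if "p \<in> S" for p
  proof -
    from that have "critical_point g p" "\<not> local_min_pt g H p" by (auto simp: S_def)
    then obtain r where "r > 0" "\<And>T R. T \<ge> 0 \<Longrightarrow> negligible (?N p r T R)"
      by (rule negligible_trapped_near_saddle) blast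
    then show ?thesis by blast
  qed
  then have "\<forall>p\<in>S. \<exists>r. r > 0 \<and> (\<forall>T\<ge>0. \<forall>R. negligible (?N p r T R))" by blast
  from bchoice[OF this] obtain r where "\<forall>p\<in>S. r p > 0 \<and> (\<forall>T\<ge>0. \<forall>R. negligible (?N p (r p) T R))" ..
  then have r: "\<And>p. p \<in> S \<Longrightarrow> r p > 0"
      "\<And>p T R. p \<in> S \<Longrightarrow> T \<ge> 0 \<Longrightarrow> negligible (?N p (r p) T R)"
    by blast+
  \<comment> \<open>Natural numbers replace the entry time and the bound, and there are countably
    many critical points, so the union is countable.\<close>
  define U where "U = (\<Union>(p, n, k) \<in> S \<times> (UNIV :: nat set) \<times> (UNIV :: nat set). ?N p (r p) (real n) (real k))"
  have "negligible U"
    unfolding U_def using S r(2) by (intro negligible_countable_Union) auto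
  \<comment> \<open>\<open>negligible\<close> refers to the completed measure; the passage to
    \<open>lborel\<close> is made afterwards.\<close>
  then have "AE z in lebesgue. z \<notin> U"
    by (intro AE_not_in) (simp add: negligible_iff_null_sets)
  then have "AE z in (lborel :: ((real^'n) \<times> (real^'n)) measure). z \<notin> U"
    by (simp add: AE_completion_iff)
  then show ?thesis
  proof eventually_elim
    fix z assume z: "z \<notin> U"
    show "\<forall>x v. is_solution g c \<beta> (fst z) (snd z) x v \<longrightarrow> (\<exists>p. local_min_pt g H p \<and> (x \<longlongrightarrow> p) at_top)"
    proof (intro allI impI)
      fix x v assume sol: "is_solution g c \<beta> (fst z) (snd z) x v"
      interpret bounded_trajectory f g H c \<beta> "fst z" "snd z" x v
        by unfold_locales (use sol bdd in auto)
      obtain p where p: "critical_point g p" "(x \<longlongrightarrow> p) at_top" by (rule converges_to_critical_point)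
      have "local_min_pt g H p"
      proof (rule ccontr)
        assume "\<not> local_min_pt g H p"
        then have pS: "p \<in> S" using p by (simp add: S_def)
        obtain R where R: "\<And>t. t \<ge> 0 \<Longrightarrow> norm (y t) \<le> R" by (rule bounds) blast
        obtain k where k: "R \<le> real k" using real_arch_simple by blast
        have "(y \<longlongrightarrow> p + \<beta> *\<^sub>R 0) at_top"
          unfolding y_def[abs_def] by (intro tendsto_intros p velocity_and_gradient_tendsto_0)
        then have "\<forall>\<^sub>F t in at_top. dist (y t) p < r p" using tendstoD r(1)[OF pS] by fastforce
        then obtain T where T: "\<And>t. t \<ge> T \<Longrightarrow> dist (y t) p < r p" by (auto simp: eventually_at_top_linorder)
        obtain n where n: "T \<le> real n" using real_arch_simple by blast
        have "z \<in> ?N p (r p) (real n) (real k)"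
          unfolding mem_Collect_eq
        proof (intro exI conjI allI impI)
          show "norm (x t + \<beta> *\<^sub>R v t) \<le> real k" if "t \<ge> 0" for t
            using R[OF that] k unfolding y_def by linarith
          show "x t + \<beta> *\<^sub>R v t \<in> ball p (r p)" if "t \<ge> real n" for t
            using T[of t] n that unfolding y_def by (simp add: dist_commute)
        qed (rule sol)
        then show False using z pS unfolding U_def by blast
      qed
      then show "\<exists>p. local_min_pt g H p \<and> (x \<longlongrightarrow> p) at_top" using p by blast
    qed
  qed
qed

end

theorem mainTheorem12:
  fixes f :: "real^'n \<Rightarrow> real" and g :: "real^'n \<Rightarrow> real^'n"
    and H :: "real^'n \<Rightarrow> real^'n^'n" and c \<beta> :: real
  assumes c_pos: "c > 0" and beta: "0 < \<beta>" "\<beta> < 2 / c"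
    and C2: "C2_grad_hess f g H" and inf: "bdd_below (range f)"
    and Morse: "morse g H"
  shows
   "(\<forall>x0 v0 x x'. is_solution g c \<beta> x0 v0 x x' \<and> bounded (x ` {0..}) \<longrightarrow>
        set_integrable lborel {0..} (\<lambda>t. (norm (g (x t)))\<^sup>2) \<and>
        ((\<lambda>t. norm (g (x t))) \<longlongrightarrow> 0) at_top \<and>
        ((\<lambda>t. norm (x' t)) \<longlongrightarrow> 0) at_top \<and>
        set_integrable lborel {0..} x' \<and>
        (\<exists>xs. critical_point g xs \<and> (x \<longlongrightarrow> xs) at_top))
    \<and>
    ((\<beta> \<noteq> 1 / c \<and>
      (\<forall>x0 v0 x x'. is_solution g c \<beta> x0 v0 x x' \<longrightarrow> bounded (x ` {0..}))) \<longrightarrow>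
      (AE z in (lborel :: ((real^'n) \<times> (real^'n)) measure).
         \<forall>x x'. is_solution g c \<beta> (fst z) (snd z) x x' \<longrightarrow>
            (\<exists>xs. local_min_pt g H xs \<and> (x \<longlongrightarrow> xs) at_top)))"
proof -
  interpret inertial_morse f g H c \<beta> by unfold_locales (fact assms)+
  show ?thesis
  proof (rule conjI, intro allI impI)
    fix x0 v0 x x' assume "is_solution g c \<beta> x0 v0 x x' \<and> bounded (x ` {0..})"
    then interpret bounded_trajectory f g H c \<beta> x0 v0 x x' by unfold_locales auto
    show "set_integrable lborel {0..} (\<lambda>t. (norm (g (x t)))\<^sup>2) \<and>
        ((\<lambda>t. norm (g (x t))) \<longlongrightarrow> 0) at_top \<and>
        ((\<lambda>t. norm (x' t)) \<longlongrightarrow> 0) at_top \<and>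
        set_integrable lborel {0..} x' \<and>
        (\<exists>xs. critical_point g xs \<and> (x \<longlongrightarrow> xs) at_top)"
      by (intro conjI gradient_square_integrable_and_vanishing(1) velocity_integrable
          tendsto_norm_zero gradient_square_integrable_and_vanishing(2) velocity_and_gradient_tendsto_0(1))
        (rule converges_to_critical_point, blast)
  qed (use AE_converges_to_local_min in blast)
qed

end
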